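(* Let $\mathbb{K}=\mathbb{R}$ or $\mathbb{C}$ and let $\ell^1$ be the Banach space of absolutely summable sequences $(x_k)_{k\ge 0}$ in $\mathbb{K}$ with its usual norm. There exists a continuous linear operator $T:\ell^1\to\ell^1$ which is chaotic and which is neither $\mathcal{U}$-frequently hypercyclic nor distributionally chaotic. In particular, $T$ is chaotic and not frequently hypercyclic.
   Context: Let $T$ be a continuous linear operator on a separable infinite-dimensional Banach space $X$ with norm $\|\cdot\|$. For $x\in X$ and $U\subset X$, the return set is $N(x,U):=\{n\ge 0: T^n x\in U\}$. For a set $A$ of non-negative integers, the lower and upper densities of $A$ are $$\underline{\mathrm{dens}}(A):=\liminf_{N\to\infty}\frac{\#(A\cap[0,N])}{N+1},\qquad \overline{\mathrm{dens}}(A):=\limsup_{N\to\infty}\frac{\#(A\cap[0,N])}{N+1}.$$ $T$ is hypercyclic if there exists $x\in X$ whose orbit $\{T^n x:n\ge 0\}$ is dense in $X$. A vector $x\in X$ is periodic for $T$ if there exists an integer $N>0$ such that $T^N x=x$. $T$ is chaotic (in the sense of Devaney) if $T$ is hypercyclic and the set of periodic vectors of $T$ is dense in $X$. $T$ is frequently hypercyclic (resp. $\mathcal{U}$-frequently hypercyclic) if there exists a vector $x\in X$ such that for every non-empty open set $U\subset X$ one has $\underline{\mathrm{dens}}(N(x,U))>0$ (resp. $\overline{\mathrm{dens}}(N(x,U))>0$). $T$ is distributionally chaotic if there exist an uncountable subset $\Gamma\subset X$ and $\varepsilon>0$ such that for all $x,y\in\Gamma$ with $x\neq y$ and every $\tau>0$,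 $$\underline{\mathrm{dens}}\{n\ge 0:\|T^n x-T^n y\|<\varepsilon\}=0\quad\text{and}\quad \overline{\mathrm{dens}}\{n\ge 0:\|T^n x-T^n y\|<\tau\}=1.$$ *)

theory Defs
  imports "HOL-Analysis.Analysis"
begin

section \<open>The Banach space of absolutely summable sequences\<close>

typedef (overloaded) ('a :: real_normed_vector) ell1 =
  "{x :: nat \<Rightarrow> 'a. summable (\<lambda>k. norm (x k))}"
  morphisms ell1_nth Abs_ell1
  by (intro exI[of _ "\<lambda>_. 0"]) simp

setup_lifting type_definition_ell1

lemma ell1_summable: "summable (\<lambda>k. norm (ell1_nth x k))"
  using ell1_nth[of x] by simp

lemma ell1_eqI: "(\<And>k. ell1_nth x k = ell1_nth y k) \<Longrightarrow> x = y"
  by (simp add: ell1_nth_inject[symmetric] fun_eq_iff)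

lemma summable_norm_add:
  fixes x y :: "nat \<Rightarrow> 'a :: real_normed_vector"
  assumes "summable (\<lambda>k. norm (x k))" "summable (\<lambda>k. norm (y k))"
  shows "summable (\<lambda>k. norm (x k + y k))"
  by (rule summable_comparison_test'[OF summable_add[OF assms], of 0])
     (simp add: norm_triangle_ineq)

lemma summable_norm_diff:
  fixes x y :: "nat \<Rightarrow> 'a :: real_normed_vector"
  assumes "summable (\<lambda>k. norm (x k))" "summable (\<lambda>k. norm (y k))"
  shows "summable (\<lambda>k. norm (x k - y k))"
  using summable_norm_add[of x "\<lambda>k. - y k"] assms by simp

instantiation ell1 :: (real_normed_vector) real_normed_vector
begin

lift_definition zero_ell1 :: "'a ell1" is "\<lambda>_. 0" by simp

lift_definition plus_ell1 :: "'a ell1 \<Rightarrow> 'a ell1 \<Rightarrow> 'a ell1" is "\<lambda>x y k. x k + y k"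
  by (rule summable_norm_add)

lift_definition minus_ell1 :: "'a ell1 \<Rightarrow> 'a ell1 \<Rightarrow> 'a ell1" is "\<lambda>x y k. x k - y k"
  by (rule summable_norm_diff)

lift_definition uminus_ell1 :: "'a ell1 \<Rightarrow> 'a ell1" is "\<lambda>x k. - x k" by simp

lift_definition scaleR_ell1 :: "real \<Rightarrow> 'a ell1 \<Rightarrow> 'a ell1" is "\<lambda>r x k. r *\<^sub>R x k"
  by (simp add: summable_mult)

lift_definition norm_ell1 :: "'a ell1 \<Rightarrow> real" is "\<lambda>x. \<Sum>k. norm (x k)" .

definition sgn_ell1 :: "'a ell1 \<Rightarrow> 'a ell1"
  where "sgn_ell1 x = inverse (norm x) *\<^sub>R x"

definition dist_ell1 :: "'a ell1 \<Rightarrow> 'a ell1 \<Rightarrow> real"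
  where "dist_ell1 x y = norm (x - y)"

definition uniformity_ell1 :: "('a ell1 \<times> 'a ell1) filter"
  where "uniformity_ell1 = (INF e\<in>{0 <..}. principal {(x, y). dist x y < e})"

definition open_ell1 :: "'a ell1 set \<Rightarrow> bool"
  where "open_ell1 U \<longleftrightarrow> (\<forall>x\<in>U. \<forall>\<^sub>F (x', y) in uniformity. x' = x \<longrightarrow> y \<in> U)"

instance
proof
  fix x y z :: "'a ell1" and a b :: real
  show "x + y + z = x + (y + z)" by transfer (simp add: add.assoc)
  show "x + y = y + x" by transfer (simp add: add.commute)
  show "0 + x = x" by transfer simp
  show "- x + x = 0" by transfer simp
  show "x - y = x + - y" by transfer simp
  show "a *\<^sub>R (x + y) = a *\<^sub>R x + a *\<^sub>R y" by transfer (simp add: scaleR_add_right)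
  show "(a + b) *\<^sub>R x = a *\<^sub>R x + b *\<^sub>R x" by transfer (simp add: scaleR_add_left)
  show "a *\<^sub>R b *\<^sub>R x = (a * b) *\<^sub>R x" by transfer simp
  show "1 *\<^sub>R x = x" by transfer simp
  show "dist x y = norm (x - y)" by (rule dist_ell1_def)
  show "sgn x = inverse (norm x) *\<^sub>R x" by (rule sgn_ell1_def)
  show "(uniformity :: ('a ell1 \<times> 'a ell1) filter)
      = (INF e\<in>{0 <..}. principal {(x, y). dist x y < e})"
    by (rule uniformity_ell1_def)
  show "open U \<longleftrightarrow> (\<forall>x\<in>U. \<forall>\<^sub>F (x', y) in uniformity. x' = x \<longrightarrow> y \<in> U)" for U :: "'a ell1 set"
    by (rule open_ell1_def)
  show "norm x = 0 \<longleftrightarrow> x = 0"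
    by transfer (auto simp: suminf_eq_zero_iff fun_eq_iff)
  show "norm (x + y) \<le> norm x + norm y"
    by transfer (simp add: suminf_add suminf_le summable_add summable_norm_add norm_triangle_ineq)
  show "norm (a *\<^sub>R x) = \<bar>a\<bar> * norm x"
    by transfer (simp add: suminf_mult)
qed

end

lemma norm_ell1_eq: "norm x = (\<Sum>k. norm (ell1_nth x k))"
  by transfer simp

lemma norm_ell1_nth_le: "norm (ell1_nth x k) \<le> norm x"
  using sum_le_suminf[OF ell1_summable, of "{k}" x] by (simp add: norm_ell1_eq)

instance ell1 :: (banach) banach
proof
  fix X :: "nat \<Rightarrow> 'a ell1"
  assume X: "Cauchy X"
  have "Cauchy (\<lambda>n. ell1_nth (X n) k)" for k
  proof (rule CauchyI)
    fix e :: real assume "e > 0"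
    with X obtain M where M: "\<And>m n. m \<ge> M \<Longrightarrow> n \<ge> M \<Longrightarrow> norm (X m - X n) < e"
      by (meson CauchyD)
    have "norm (ell1_nth (X m) k - ell1_nth (X n) k) \<le> norm (X m - X n)" for m n
      using norm_ell1_nth_le[of "X m - X n" k] by (simp add: minus_ell1.rep_eq)
    with M show "\<exists>M. \<forall>m\<ge>M. \<forall>n\<ge>M. norm (ell1_nth (X m) k - ell1_nth (X n) k) < e"
      by (meson le_less_trans)
  qed
  then have "\<exists>l. \<forall>k. (\<lambda>n. ell1_nth (X n) k) \<longlonglongrightarrow> l k"
    by (intro choice) (auto simp: Cauchy_convergent_iff convergent_def)
  then obtain l where l: "\<And>k. (\<lambda>n. ell1_nth (X n) k) \<longlonglongrightarrow> l k" by auto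
  have est: "\<exists>M. \<forall>n\<ge>M. \<forall>K. (\<Sum>k<K. norm (ell1_nth (X n) k - l k)) \<le> e" if "e > 0" for e
  proof -
    from X that obtain M where M: "\<And>m n. m \<ge> M \<Longrightarrow> n \<ge> M \<Longrightarrow> norm (X m - X n) < e"
      by (meson CauchyD)
    have "(\<Sum>k<K. norm (ell1_nth (X n) k - l k)) \<le> e" if n: "n \<ge> M" for n K
    proof (rule LIMSEQ_le_const2)
      show "(\<lambda>m. \<Sum>k<K. norm (ell1_nth (X n) k - ell1_nth (X m) k))
          \<longlonglongrightarrow> (\<Sum>k<K. norm (ell1_nth (X n) k - l k))"
        by (intro tendsto_intros l)
      have "(\<Sum>k<K. norm (ell1_nth (X n) k - ell1_nth (X m) k)) \<le> e" if "m \<ge> M" for m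
      proof -
        have "(\<Sum>k<K. norm (ell1_nth (X n - X m) k)) \<le> norm (X n - X m)"
          unfolding norm_ell1_eq by (rule sum_le_suminf[OF ell1_summable]) auto
        then show ?thesis
          using M[OF n that] by (simp add: minus_ell1.rep_eq)
      qed
      then show "\<exists>N. \<forall>m\<ge>N. (\<Sum>k<K. norm (ell1_nth (X n) k - ell1_nth (X m) k)) \<le> e"
        by blast
    qed
    then show ?thesis by blast
  qed
  have summ: "summable (\<lambda>k. norm (l k))"
  proof -
    obtain M where M: "\<And>K. (\<Sum>k<K. norm (ell1_nth (X M) k - l k)) \<le> 1"
      using est[of 1] by auto
    have "summable (\<lambda>k. norm (ell1_nth (X M) k - l k))"
      by (rule bounded_imp_summable[where B = 1])
         (simp_all only: lessThan_Suc_atMost[symmetric] M norm_ge_zero)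
    from summable_norm_diff[OF ell1_summable[of "X M"] this] show ?thesis by simp
  qed
  define L where "L = Abs_ell1 l"
  have L: "ell1_nth L = l" unfolding L_def by (rule Abs_ell1_inverse) (simp add: summ)
  have "X \<longlonglongrightarrow> L"
  proof (rule LIMSEQ_I)
    fix r :: real assume "r > 0"
    then obtain M where
      M: "\<And>n K. n \<ge> M \<Longrightarrow> (\<Sum>k<K. norm (ell1_nth (X n) k - l k)) \<le> r / 2"
      using est[of "r / 2"] by auto
    have "norm (X n - L) < r" if "n \<ge> M" for n
    proof -
      have "norm (X n - L) \<le> r / 2"
        unfolding norm_ell1_eq
        by (rule suminf_le_const[OF ell1_summable]) (simp only: minus_ell1.rep_eq L M[OF that])
      with \<open>r > 0\<close> show ?thesis by simp
    qed
    then show "\<exists>no. \<forall>n\<ge>no. norm (X n - L) < r" by blast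
  qed
  then show "convergent X" by (rule convergentI)
qed

text \<open>
  Multiplication by scalars of the base field. For complex sequences, linearity with respect to
  this operation is stronger than the real linearity provided by the type class.
\<close>

lift_definition ell1_scale :: "'a :: real_normed_field \<Rightarrow> 'a ell1 \<Rightarrow> 'a ell1"
  is "\<lambda>c x k. c * x k"
  by (simp add: norm_mult summable_mult)

lemma vector_space_ell1_scale: "vector_space ell1_scale"
  by unfold_locales (transfer; simp add: algebra_simps)+

lemma norm_ell1_scale: "norm (ell1_scale c x) = norm c * norm x"
  by transfer (simp add: norm_mult suminf_mult)

definition ell1_operator :: "('a :: real_normed_field ell1 \<Rightarrow> 'a ell1) \<Rightarrow> bool"
  where "ell1_operator T \<longleftrightarrow>
    Vector_Spaces.linear ell1_scale ell1_scale T \<and> continuous_on UNIV T"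


section \<open>Densities and linear dynamics\<close>

definition lower_density :: "nat set \<Rightarrow> ereal"
  where "lower_density A = liminf (\<lambda>N. ereal (real (card (A \<inter> {0..N})) / real (N + 1)))"

definition upper_density :: "nat set \<Rightarrow> ereal"
  where "upper_density A = limsup (\<lambda>N. ereal (real (card (A \<inter> {0..N})) / real (N + 1)))"

definition return_set :: "('a \<Rightarrow> 'a) \<Rightarrow> 'a \<Rightarrow> 'a set \<Rightarrow> nat set"
  where "return_set T x U = {n. (T ^^ n) x \<in> U}"

definition hypercyclic :: "('a :: banach \<Rightarrow> 'a) \<Rightarrow> bool"
  where "hypercyclic T \<longleftrightarrow> (\<exists>x. closure (range (\<lambda>n. (T ^^ n) x)) = UNIV)"

definition periodic_vector :: "('a :: banach \<Rightarrow> 'a) \<Rightarrow> 'a \<Rightarrow> bool"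
  where "periodic_vector T x \<longleftrightarrow> (\<exists>N>0. (T ^^ N) x = x)"

definition chaotic :: "('a :: banach \<Rightarrow> 'a) \<Rightarrow> bool"
  where "chaotic T \<longleftrightarrow> hypercyclic T \<and> closure {x. periodic_vector T x} = UNIV"

definition frequently_hypercyclic :: "('a :: banach \<Rightarrow> 'a) \<Rightarrow> bool"
  where "frequently_hypercyclic T \<longleftrightarrow>
    (\<exists>x. \<forall>U. open U \<and> U \<noteq> {} \<longrightarrow> lower_density (return_set T x U) > 0)"

definition U_frequently_hypercyclic :: "('a :: banach \<Rightarrow> 'a) \<Rightarrow> bool"
  where "U_frequently_hypercyclic T \<longleftrightarrow>
    (\<exists>x. \<forall>U. open U \<and> U \<noteq> {} \<longrightarrow> upper_density (return_set T x U) > 0)"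

definition distributionally_chaotic :: "('a :: banach \<Rightarrow> 'a) \<Rightarrow> bool"
  where "distributionally_chaotic T \<longleftrightarrow>
    (\<exists>\<Gamma> \<epsilon>. uncountable \<Gamma> \<and> \<epsilon> > 0 \<and>
      (\<forall>x\<in>\<Gamma>. \<forall>y\<in>\<Gamma>. \<forall>\<tau>. x \<noteq> y \<and> \<tau> > 0 \<longrightarrow>
        lower_density {n. norm ((T ^^ n) x - (T ^^ n) y) < \<epsilon>} = 0 \<and>
        upper_density {n. norm ((T ^^ n) x - (T ^^ n) y) < \<tau>} = 1))"

end

theory Submission
  imports Defs
begin

text \<open>
  The unit vectors are cut into consecutive finite blocks, block \<open>n\<close> having length \<open>L n\<close>. The operator
  is a weighted shift inside each block, doubling during the first \<open>d n\<close> steps (the ramp) and isometric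
  afterwards. At the end of the block it returns to the start with the factor \<open>- 1 / 2 ^ d n\<close> and,
  in addition, emits \<open>1 / 2 ^ d n\<close> times a feedback vector \<open>f n\<close> supported in the earlier blocks. So one
  lap sends the first vector \<open>e n\<close> of the block to \<open>f n - e n\<close>. Everything follows from three observations.

  Periodicity. Suppose that \<open>L n\<close> is a period on the earlier blocks. Then after two laps the two emissions of
  \<open>f n\<close> cancel, thanks to the minus sign, so \<open>2 * L n\<close> is a period on block \<open>n\<close>; since it divides
  \<open>L (Suc n)\<close>, the induction continues. Hence all finitely supported vectors are periodic
  (\<open>funpow_lap_initial\<close>).

  Hypercyclicity. Let \<open>y\<close> be a dense sequence of finitely supported vectors and let the coefficients \<open>a n\<close> decay
  fast. With \<open>f n = (y n - (\<Sum>m<n. a m e m)) / a n\<close> the orbit of \<open>x = (\<Sum>n. a n e n)\<close> is dense: at time \<open>L n\<close>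
  the earlier terms of \<open>x\<close> are back where they were, the term \<open>a n e n\<close> has turned into
  \<open>y n - (\<Sum>m<n. a m e m) - a n e n\<close>, and the later terms are still negligible, because they are much smaller
  than \<open>1 / 2 ^ L n\<close> (\<open>hypercyclic_vector_visits\<close>).

  Orbits are rarely small. For every \<open>z \<noteq> 0\<close> there is \<open>c > 0\<close> such that the times at which the orbit of \<open>z\<close> has norm
  less than \<open>c\<close> form a set of upper density 0 (\<open>orbit_rarely_small\<close>). This one fact excludes
  (upper) frequent hypercyclicity, because the ball of radius \<open>c\<close> is visited too rarely, and distributional
  chaos, because differences of orbits are orbits. To see it, let \<open>A\<close> be the largest modulus of a coordinate of \<open>z\<close> and call
  block \<open>n\<close> heavy if one of its coordinates would have modulus at least \<open>A\<close> once transported beyond the ramp.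
  This transported coordinate is at least \<open>A\<close> except during the passages through the ramp, which take the
  proportion \<open>d n / L n \<le> 1 / 2 ^ n\<close> of the time, and is never below \<open>A / 2 ^ d n\<close>. What can disturb it is feedback
  from later blocks. The vectors \<open>f m / 2 ^ d m\<close> and their orbits are so small that a block
  which is not heavy disturbs it by a negligible amount, and a heavy block can disturb it
  substantially only after a coordinate has climbed its ramp and completed the lap. Hence, up to time \<open>N\<close>, the
  last heavy block that had the time for this is disturbed only by a negligible amount. If there are finitely many heavy blocks,
  the last one bounds the whole orbit away from 0; otherwise the index of the relevant block tends to infinity
  with \<open>N\<close>, and the proportion of exceptional times tends to 0.
\<close>

section \<open>Operators on the sequence space with prescribed columns\<close>

lemmas ell1_nth_simps [simp] =
  zero_ell1.rep_eq plus_ell1.rep_eq minus_ell1.rep_eq uminus_ell1.rep_eq scaleR_ell1.rep_eq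
  ell1_scale.rep_eq

lift_definition ell1_unit :: "nat \<Rightarrow> 'a :: real_normed_field ell1"
  is "\<lambda>k i. if i = k then 1 else 0"
  by (rule summable_finite[of "{k}" for k]) auto

declare ell1_unit.rep_eq [simp]

lemma norm_ell1_unit [simp]: "norm (ell1_unit k :: 'a :: real_normed_field ell1) = 1"
proof -
  have "norm (ell1_unit k :: 'a ell1) = (\<Sum>i\<in>{k}. norm (ell1_nth (ell1_unit k :: 'a ell1) i))"
    unfolding norm_ell1_eq by (rule suminf_finite) auto
  then show ?thesis by simp
qed

lemma bounded_linear_ell1_nth: "bounded_linear (\<lambda>x. ell1_nth x k)"
  by (rule bounded_linear_intro[where K = 1]) (auto simp: norm_ell1_nth_le)

lemma bounded_linear_ell1_scale:
  "bounded_linear (ell1_scale c :: 'a :: real_normed_field ell1 \<Rightarrow> _)"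
  by (rule bounded_linear_intro[where K = "norm c"])
     (auto simp: norm_ell1_scale algebra_simps intro!: ell1_eqI)

lemma ell1_scale_add_left: "ell1_scale (c + d) x = ell1_scale c x + ell1_scale d x"
  by (rule ell1_eqI) (simp add: algebra_simps)

lemma ell1_scale_diff_left: "ell1_scale (c - d) x = ell1_scale c x - ell1_scale d x"
  by (rule ell1_eqI) (simp add: algebra_simps)

lemma ell1_scale_of_real: "ell1_scale (of_real r) x = r *\<^sub>R x"
  by (rule ell1_eqI) (simp add: scaleR_conv_of_real)

lemma ell1_nth_sum: "ell1_nth (\<Sum>i\<in>I. f i) k = (\<Sum>i\<in>I. ell1_nth (f i) k)"
  by (rule linear_sum) (rule bounded_linear.linear[OF bounded_linear_ell1_nth])

lemma ell1_nth_sum_unit: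
  fixes c :: "nat \<Rightarrow> 'a :: real_normed_field"
  shows "ell1_nth (\<Sum>i<K. ell1_scale (c i) (ell1_unit i)) k = (if k < K then c k else 0)"
proof -
  have "ell1_nth (\<Sum>i<K. ell1_scale (c i) (ell1_unit i)) k = (\<Sum>i<K. if k = i then c i else 0)"
    unfolding ell1_nth_sum by (intro sum.cong) auto
  then show ?thesis by simp
qed

lemma ell1_sums_unit:
  fixes x :: "'a :: real_normed_field ell1"
  shows "(\<lambda>k. ell1_scale (ell1_nth x k) (ell1_unit k)) sums x"
  unfolding sums_def
proof (rule LIMSEQ_I)
  fix r :: real assume "r > 0"
  then obtain N where N: "\<And>K. K \<ge> N \<Longrightarrow> norm (\<Sum>i. norm (ell1_nth x (i + K))) < r"
    using suminf_exist_split[OF _ ell1_summable] by metis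
  have "norm ((\<Sum>k<K. ell1_scale (ell1_nth x k) (ell1_unit k)) - x) < r" if "K \<ge> N" for K
  proof -
    let ?D = "(\<Sum>k<K. ell1_scale (ell1_nth x k) (ell1_unit k)) - x"
    have D: "ell1_nth ?D i = (if i < K then 0 else - ell1_nth x i)" for i
      by (simp add: ell1_nth_sum_unit)
    have "norm ?D = (\<Sum>i. norm (ell1_nth ?D (i + K))) + (\<Sum>i<K. norm (ell1_nth ?D i))"
      unfolding norm_ell1_eq by (rule suminf_split_initial_segment[OF ell1_summable])
    also have "\<dots> = (\<Sum>i. norm (ell1_nth x (i + K)))"
      unfolding D by simp
    finally show ?thesis using N[OF that] by simp
  qed
  then show "\<exists>N. \<forall>K\<ge>N. norm ((\<Sum>k<K. ell1_scale (ell1_nth x k) (ell1_unit k)) - x) < r"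
    by blast
qed

text \<open>
  On this space every bounded choice of images of the unit vectors extends to a bounded operator.
\<close>
definition ell1_extend :: "(nat \<Rightarrow> 'a :: {real_normed_field, banach} ell1) \<Rightarrow> 'a ell1 \<Rightarrow> 'a ell1"
  where "ell1_extend u x = (\<Sum>k. ell1_scale (ell1_nth x k) (u k))"

context
  fixes u :: "nat \<Rightarrow> 'a :: {real_normed_field, banach} ell1" and C :: real
  assumes u: "\<And>k. norm (u k) \<le> C"
begin

lemma norm_ell1_scale_column_le:
  "norm (ell1_scale (ell1_nth x k) (u k)) \<le> C * norm (ell1_nth x k)"
  unfolding norm_ell1_scale mult.commute[of C] by (intro mult_left_mono u norm_ge_zero)

lemma summable_norm_ell1_extend:
  "summable (\<lambda>k. norm (ell1_scale (ell1_nth x k) (u k)))"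
proof (rule summable_comparison_test')
  show "summable (\<lambda>k. C * norm (ell1_nth x k))"
    by (intro summable_mult ell1_summable)
  show "norm (norm (ell1_scale (ell1_nth x k) (u k))) \<le> C * norm (ell1_nth x k)" if "k \<ge> 0" for k
    using norm_ell1_scale_column_le by simp
qed

lemma ell1_extend_sums: "(\<lambda>k. ell1_scale (ell1_nth x k) (u k)) sums ell1_extend u x"
  unfolding ell1_extend_def
  by (rule summable_sums[OF summable_norm_cancel[OF summable_norm_ell1_extend]])

lemma norm_ell1_extend_le: "norm (ell1_extend u x) \<le> C * norm x"
proof -
  have "norm (ell1_extend u x) \<le> (\<Sum>k. norm (ell1_scale (ell1_nth x k) (u k)))"
    unfolding ell1_extend_def by (rule summable_norm[OF summable_norm_ell1_extend])
  also have "\<dots> \<le> (\<Sum>k. C * norm (ell1_nth x k))"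
    by (intro suminf_le summable_norm_ell1_extend summable_mult ell1_summable
        norm_ell1_scale_column_le)
  also have "\<dots> = C * norm x"
    by (simp add: suminf_mult ell1_summable norm_ell1_eq)
  finally show ?thesis .
qed

lemma ell1_extend_add: "ell1_extend u (x + y) = ell1_extend u x + ell1_extend u y"
proof (rule sums_unique2[OF ell1_extend_sums])
  show "(\<lambda>k. ell1_scale (ell1_nth (x + y) k) (u k)) sums (ell1_extend u x + ell1_extend u y)"
    using sums_add[OF ell1_extend_sums[of x] ell1_extend_sums[of y]]
    unfolding plus_ell1.rep_eq ell1_scale_add_left .
qed

lemma ell1_extend_scale: "ell1_extend u (ell1_scale c x) = ell1_scale c (ell1_extend u x)"
proof (rule sums_unique2[OF ell1_extend_sums])
  have "ell1_scale (c * d) v = ell1_scale c (ell1_scale d v)" for d and v :: "'a ell1"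
    by (rule ell1_eqI) (simp add: mult.assoc)
  then show "(\<lambda>k. ell1_scale (ell1_nth (ell1_scale c x) k) (u k)) sums ell1_scale c (ell1_extend u x)"
    using bounded_linear.sums[OF bounded_linear_ell1_scale ell1_extend_sums, of c x] by simp
qed

lemma bounded_linear_ell1_extend: "bounded_linear (ell1_extend u)"
proof (rule bounded_linear_intro[where K = C])
  show "ell1_extend u (r *\<^sub>R x) = r *\<^sub>R ell1_extend u x" for r x
    using ell1_extend_scale[of "of_real r" x] unfolding ell1_scale_of_real .
qed (use norm_ell1_extend_le in \<open>simp_all add: ell1_extend_add mult.commute\<close>)

lemma ell1_operator_ell1_extend: "ell1_operator (ell1_extend u)"
  unfolding ell1_operator_def Vector_Spaces.linear_iff
  by (auto simp: vector_space_ell1_scale ell1_extend_add ell1_extend_scale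
      intro: linear_continuous_on bounded_linear_ell1_extend)

lemma ell1_extend_unit: "ell1_extend u (ell1_unit k) = u k"
proof -
  have "ell1_extend u (ell1_unit k) = (\<Sum>i\<in>{k}. ell1_scale (ell1_nth (ell1_unit k) i) (u i))"
    unfolding ell1_extend_def by (rule suminf_finite) (auto intro!: ell1_eqI)
  also have "\<dots> = u k" by (auto intro!: ell1_eqI)
  finally show ?thesis .
qed

end

section \<open>A dense sequence and largest coordinates\<close>

text \<open>
  A countable dense set of finitely supported vectors is listed with infinite repetition by means of the pairing
  function, so that each vector also occurs at indices that are large enough for the bounds on support and norm;
  occurrences that come too early are replaced by 0.
\<close>
lemma ell1_dense_sequence:
  fixes b :: "nat \<Rightarrow> nat"
  assumes b: "\<And>n. n \<le> b n"
  obtains y :: "nat \<Rightarrow> 'a :: {real_normed_field, banach, second_countable_topology} ell1"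
  where "\<And>n k. b n \<le> k \<Longrightarrow> ell1_nth (y n) k = 0" "\<And>n. norm (y n) \<le> real n"
    "\<And>x e N. e > 0 \<Longrightarrow> \<exists>n\<ge>N. norm (y n - x) < e"
proof -
  obtain D :: "'a set" where D: "countable D" "\<And>X. open X \<Longrightarrow> X \<noteq> {} \<Longrightarrow> \<exists>d\<in>D. d \<in> X"
    using countable_dense_exists by metis
  have D_ne: "D \<noteq> {}" using D(2)[of UNIV] by auto
  define q :: "'a list \<Rightarrow> 'a ell1"
    where "q l = (\<Sum>i<length l. ell1_scale (l ! i) (ell1_unit i))" for l
  define c where "c = (\<lambda>i. q (from_nat_into (lists D) i))"
  have fin: "\<exists>K. \<forall>k\<ge>K. ell1_nth (c i) k = 0" for i
    unfolding c_def q_def ell1_nth_sum_unit by (meson not_le)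
  have dense: "\<exists>i. norm (c i - x) < e" if "e > 0" for x e
  proof -
    obtain K where K: "norm ((\<Sum>k<K. ell1_scale (ell1_nth x k) (ell1_unit k)) - x) < e / 2"
      using LIMSEQ_D[OF ell1_sums_unit[of x, unfolded sums_def], of "e / 2"] \<open>e > 0\<close> by auto
    have "\<exists>d\<in>D. norm (d - ell1_nth x k) < e / (2 * Suc K)" for k
    proof -
      have "ball (ell1_nth x k) (e / (2 * Suc K)) \<noteq> {}"
        using divide_pos_pos[OF \<open>e > 0\<close>, of "2 * Suc K"] by force
      then show ?thesis
        using D(2)[OF open_ball] by (force simp: dist_norm norm_minus_commute)
    qed
    then obtain d where d: "\<And>k. d k \<in> D" "\<And>k. norm (d k - ell1_nth x k) < e / (2 * Suc K)"
      by metis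
    let ?l = "map d [0..<K]"
    have "?l \<in> lists D" using d(1) by auto
    then obtain i where i: "from_nat_into (lists D) i = ?l"
      using from_nat_into_surj[OF countable_lists[OF D(1)]] by metis
    have "c i = (\<Sum>k<K. ell1_scale (d k) (ell1_unit k))"
      unfolding c_def i q_def by simp
    then have "c i - (\<Sum>k<K. ell1_scale (ell1_nth x k) (ell1_unit k))
        = (\<Sum>k<K. ell1_scale (d k - ell1_nth x k) (ell1_unit k))"
      by (simp add: sum_subtractf ell1_scale_diff_left)
    also have "norm \<dots> \<le> (\<Sum>k<K. e / (2 * Suc K))"
      by (rule sum_norm_le) (use d(2) in \<open>simp add: norm_ell1_scale less_imp_le\<close>)
    also have "\<dots> = real K * (e / (2 * Suc K))" by simp
    also have "\<dots> \<le> e / 2" using \<open>e > 0\<close> by (simp add: field_simps)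
    finally show ?thesis using K
      by (intro exI[of _ i])
         (use norm_triangle_ineq[of "c i - (\<Sum>k<K. ell1_scale (ell1_nth x k) (ell1_unit k))"
           "(\<Sum>k<K. ell1_scale (ell1_nth x k) (ell1_unit k)) - x"] in auto)
  qed
  define y where "y n = (let v = c (fst (prod_decode n)) in
     if (\<forall>k\<ge>b n. ell1_nth v k = 0) \<and> norm v \<le> real n then v else 0)" for n
  show ?thesis
  proof (rule that)
    show "ell1_nth (y n) k = 0" if "b n \<le> k" for n k
      using that by (auto simp: y_def Let_def)
    show "norm (y n) \<le> real n" for n
      by (auto simp: y_def Let_def)
    show "\<exists>n\<ge>N. norm (y n - x) < e" if "e > 0" for x e N
    proof -
      obtain i where i: "norm (c i - x) < e" using dense[OF \<open>e > 0\<close>] by blast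
      obtain K where K: "\<And>k. k \<ge> K \<Longrightarrow> ell1_nth (c i) k = 0" using fin by blast
      obtain M :: nat where M: "norm (c i) \<le> M" using real_arch_simple by blast
      define n where "n = prod_encode (i, N + K + M)"
      have n: "n \<ge> N + K + M" unfolding n_def by (rule le_prod_encode_2)
      have "y n = c i"
        using n K M order_trans[OF n b[of n]] by (auto simp: y_def Let_def n_def)
      then show ?thesis using i n by (intro exI[of _ n]) auto
    qed
  qed
qed
lemma ell1_max_coordinate:
  assumes "z \<noteq> 0"
  obtains k0 where "0 < norm (ell1_nth z k0)" "\<And>k. norm (ell1_nth z k) \<le> norm (ell1_nth z k0)"
proof -
  obtain k1 where k1: "ell1_nth z k1 \<noteq> 0" using assms ell1_eqI[of z 0] by auto
  have "(\<lambda>k. norm (ell1_nth z k)) \<longlonglongrightarrow> 0" by (rule summable_LIMSEQ_zero[OF ell1_summable])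
  then obtain K where K: "\<And>k. k \<ge> K \<Longrightarrow> norm (ell1_nth z k) < norm (ell1_nth z k1)"
    using order_tendstoD(2)[of _ 0 sequentially "norm (ell1_nth z k1)"] k1
    unfolding eventually_sequentially by auto
  have k1K: "k1 < K" using K[of k1] by (meson less_irrefl not_less)
  let ?M = "Max ((\<lambda>k. norm (ell1_nth z k)) ` {..<K})"
  have "?M \<in> (\<lambda>k. norm (ell1_nth z k)) ` {..<K}" using k1K by (intro Max_in) auto
  then obtain k0 where k0: "norm (ell1_nth z k0) = ?M" by auto
  have less: "norm (ell1_nth z k) \<le> ?M" if "k < K" for k using that by (intro Max_ge) auto
  show ?thesis
  proof (rule that[of k0])
    show "0 < norm (ell1_nth z k0)" using less[OF k1K] k1 unfolding k0
      by (meson less_le_trans zero_less_norm_iff)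
    show "norm (ell1_nth z k) \<le> norm (ell1_nth z k0)" for k
      using less[of k] less[OF k1K] K[of k] unfolding k0 by (cases "k < K") auto
  qed
qed

section \<open>Periods, block sums and densities\<close>

lemma funpow_dvd_period: "(f ^^ p) x = x \<Longrightarrow> p dvd q \<Longrightarrow> (f ^^ q) x = x"
  using funpow_mod_eq[of p f x q] by simp

lemma add_mod_inj:
  fixes L :: nat
  assumes "i < L" "i' < L" "(i + j) mod L = (i' + j) mod L"
  shows "i = i'"
proof -
  have le: "a = b" if "a \<le> b" "b < L" "(a + j) mod L = (b + j) mod L" for a b
  proof -
    have "L dvd (b + j) - (a + j)"
      using that by (subst mod_eq_dvd_iff_nat[symmetric]) auto
    then show ?thesis using that by (auto dest: dvd_imp_le)
  qed
  show ?thesis using le[of i i'] le[of i' i] assms by (cases "i \<le> i'") auto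
qed

lemma sum_lessThan_add:
  fixes f :: "nat \<Rightarrow> real"
  shows "(\<Sum>k<m + n. f k) = (\<Sum>k<m. f k) + (\<Sum>i<n. f (m + i))"
  by (induction n) auto

lemma upper_density_le_0I:
  assumes "\<And>e. e > 0 \<Longrightarrow> \<forall>\<^sub>F N in sequentially. real (card (S \<inter> {0..N})) / real (N + 1) \<le> e"
  shows "upper_density S \<le> 0"
proof (rule ereal_le_epsilon2)
  fix e :: real assume "e > 0"
  have "upper_density S \<le> ereal e"
    unfolding upper_density_def
    by (rule Limsup_bounded) (use assms[OF \<open>e > 0\<close>] in simp)
  then show "upper_density S \<le> 0 + ereal e" by simp
qed

lemma lower_density_le_upper_density: "lower_density S \<le> upper_density S"
  unfolding lower_density_def upper_density_def by (rule Liminf_le_Limsup) simp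

lemma divide_le_of_le_mult: "x \<le> c * M / p \<Longrightarrow> 0 < M \<Longrightarrow> x / M \<le> c / p" for x :: real
  by (simp add: pos_divide_le_eq mult.commute)

section \<open>Block lengths and weights\<close>

text \<open>
  The growth has to be balanced. The ramp of block \<open>Suc n\<close> must be long compared with block \<open>n\<close>, because \<open>2 ^ ramp_len\<close>
  has to beat \<open>16 ^ block_len n\<close> (see \<open>return_bound\<close> below); but it must be a small part, here
  \<open>1 / 2 ^ Suc n\<close>, of block \<open>Suc n\<close>. A quadratic exponent in the block lengths achieves both, and makes
  \<open>2 * block_len n\<close> a divisor of \<open>block_len (Suc n)\<close>.
\<close>
fun block_len :: "nat \<Rightarrow> nat"
  where "block_len 0 = 1" | "block_len (Suc n) = 2 ^ (n + 5) * block_len n"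

fun ramp_len :: "nat \<Rightarrow> nat"
  where "ramp_len 0 = 0" | "ramp_len (Suc n) = 16 * block_len n"

text \<open>
  The coefficients of the hypercyclic vector. They decay so fast that an amplification by \<open>2 ^ block_len n\<close>, the
  most that is possible in one lap of block \<open>n\<close>, leaves those with index above \<open>n\<close> small.
\<close>
fun start_coeff :: "nat \<Rightarrow> real"
  where "start_coeff 0 = 1" | "start_coeff (Suc n) = 1 / 4 ^ block_len n"

definition block_start :: "nat \<Rightarrow> nat"
  where "block_start n = (\<Sum>m<n. block_len m)"

definition block_of :: "nat \<Rightarrow> nat"
  where "block_of k = (LEAST n. k < block_start (Suc n))"

text \<open>
  The amplification between the start of block \<open>n\<close> and its position \<open>i\<close>.
\<close>
definition weight :: "nat \<Rightarrow> nat \<Rightarrow> real"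
  where "weight n i = 2 ^ min i (ramp_len n)"

text \<open>
  A bound for the whole orbit of the feedback vector of block \<open>n\<close>: that vector has norm at most
  \<open>2 * n / start_coeff n\<close>, and its orbit has the period \<open>2 * block_len (n - 1)\<close>, which allows an amplification by at most
  \<open>2 ^ (2 * block_len (n - 1))\<close>. For \<open>n = 0\<close> the truncated subtraction is harmless, as there is no feedback.
\<close>
definition return_bound :: "nat \<Rightarrow> real"
  where "return_bound n = 4 ^ block_len (n - 1) * (2 * real n / start_coeff n)"

lemma block_len_ge: "n + 1 \<le> block_len n"
proof (induction n)
  case (Suc n)
  have "Suc n + 1 \<le> 2 * (n + 1)" by simp
  also have "\<dots> \<le> 2 ^ (n + 5) * block_len n"
    by (intro mult_mono Suc.IH) (auto simp: self_le_power)
  finally show ?case by simp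
qed simp

lemma block_len_pos [simp]: "0 < block_len n"
  using block_len_ge[of n] by linarith

lemma block_len_less_Suc: "block_len n < block_len (Suc n)"
proof -
  have "1 < (2::nat) ^ (n + 5)" by (rule one_less_power) auto
  then have "1 * block_len n < 2 ^ (n + 5) * block_len n"
    by (rule mult_strict_right_mono) simp
  then show ?thesis by simp
qed

lemma block_len_add_le: "block_len n + r \<le> block_len (n + r)"
proof (induction r)
  case (Suc r)
  then show ?case using block_len_less_Suc[of "n + r"] by (simp del: block_len.simps)
qed simp

lemma double_block_len_dvd_Suc: "2 * block_len n dvd block_len (Suc n)"
  by (simp add: power_add mult.assoc[symmetric])

lemma ramp_len_le: "ramp_len n * 2 ^ n \<le> block_len n"
  by (cases n) (auto simp: power_add algebra_simps)

lemma double_ramp_len_le: "2 * ramp_len n \<le> block_len n"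
proof (cases n)
  case (Suc m)
  have "ramp_len n * 2 ^ 1 \<le> ramp_len n * 2 ^ n"
    using Suc by (intro mult_left_mono power_increasing) auto
  then have "ramp_len n * 2 ^ 1 \<le> block_len n"
    using ramp_len_le by (rule order_trans)
  then show ?thesis by simp
qed simp

lemma ramp_len_less: "ramp_len n < block_len n"
proof (cases n)
  case (Suc m)
  have "16 * block_len m < 2 ^ (m + 5) * block_len m"
  proof (intro mult_strict_right_mono)
    have "(16::nat) < 2 ^ 5" by simp
    also have "\<dots> \<le> 2 ^ (m + 5)" by (intro power_increasing) auto
    finally show "(16::nat) < 2 ^ (m + 5)" .
  qed simp
  then show ?thesis using Suc by simp
qed simp

lemma ramp_len_mono: "m \<le> n \<Longrightarrow> ramp_len m \<le> ramp_len n"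
proof (rule lift_Suc_mono_le[of ramp_len])
  show "ramp_len n \<le> ramp_len (Suc n)" for n
    using ramp_len_less[of n] by simp
qed

lemma block_start_Suc: "block_start (Suc n) = block_start n + block_len n"
  by (simp add: block_start_def)

lemma block_start_0 [simp]: "block_start 0 = 0"
  by (simp add: block_start_def)

lemma block_start_mono: "m \<le> n \<Longrightarrow> block_start m \<le> block_start n"
  by (rule lift_Suc_mono_le[of block_start]) (simp_all add: block_start_Suc)

lemma block_start_ge: "n \<le> block_start n"
proof (induction n)
  case (Suc n)
  then show ?case using block_len_pos[of n] by (simp add: block_start_Suc del: block_len_pos)
qed simp

lemma block_end_le: "m < n \<Longrightarrow> i < block_len m \<Longrightarrow> block_start m + i < block_start n"
  using block_start_mono[of "Suc m" n] by (simp add: block_start_Suc)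

lemma block_of_eq: "i < block_len n \<Longrightarrow> block_of (block_start n + i) = n"
  unfolding block_of_def
proof (rule Least_equality)
  show "n \<le> m" if "block_start n + i < block_start (Suc m)" for m
    using that block_start_mono[of "Suc m" n] by (cases "Suc m \<le> n") auto
qed (simp add: block_start_Suc)

lemma block_cases:
  obtains n i where "k = block_start n + i" "i < block_len n"
proof -
  define n where "n = block_of k"
  have ex: "k < block_start (Suc k)" using block_start_ge[of "Suc k"] by simp
  have 1: "k < block_start (Suc n)"
    unfolding n_def block_of_def by (rule LeastI[where P = "\<lambda>n. k < block_start (Suc n)", OF ex])
  have 2: "block_start n \<le> k"
  proof (cases n)
    case (Suc m)
    then have "\<not> k < block_start (Suc m)"
      using not_less_Least[of m "\<lambda>n. k < block_start (Suc n)"]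
      unfolding n_def block_of_def by simp
    then show ?thesis using Suc by simp
  qed simp
  show ?thesis
    by (rule that[of n "k - block_start n"]) (use 1 2 in \<open>auto simp: block_start_Suc\<close>)
qed

lemma block_less_iff:
  "i < block_len n \<Longrightarrow> block_start n + i < block_start m \<longleftrightarrow> n < m"
  using block_end_le[of n m i] block_start_mono[of m n] by (cases "n < m") auto

lemma block_eq_iff:
  assumes "i < block_len n" "j < block_len m"
  shows "block_start n + i = block_start m + j \<longleftrightarrow> n = m \<and> i = j"
  using block_of_eq[OF assms(1)] block_of_eq[OF assms(2)] by auto

lemma weight_0 [simp]: "weight n 0 = 1"
  by (simp add: weight_def)

lemma weight_ge_1: "1 \<le> weight n i"
  by (simp add: weight_def)

lemma weight_pos [simp]: "0 < weight n i"
  by (simp add: weight_def)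

lemma weight_le: "weight n i \<le> 2 ^ ramp_len n"
  by (simp add: weight_def)

lemma weight_after_ramp: "ramp_len n \<le> i \<Longrightarrow> weight n i = 2 ^ ramp_len n"
  by (simp add: weight_def min_def)

lemma weight_last: "Suc i = block_len n \<Longrightarrow> weight n i = 2 ^ ramp_len n"
  using ramp_len_less[of n] by (intro weight_after_ramp) simp

lemma weight_Suc_le: "weight n (Suc i) \<le> 2 * weight n i"
proof -
  have "min (Suc i) (ramp_len n) \<le> Suc (min i (ramp_len n))" by simp
  then have "(2::real) ^ min (Suc i) (ramp_len n) \<le> 2 ^ Suc (min i (ramp_len n))"
    by (intro power_increasing) auto
  then show ?thesis by (simp add: weight_def)
qed

lemma start_coeff_pos [simp]: "0 < start_coeff n"
  by (cases n) auto

lemma start_coeff_le_1: "start_coeff n \<le> 1"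
  by (cases n) (auto simp: divide_le_eq)

lemma return_bound_nonneg: "0 \<le> return_bound n"
  unfolding return_bound_def using start_coeff_pos[of n] by (simp add: less_imp_le)

lemma return_bound_0 [simp]: "return_bound 0 = 0"
  by (simp add: return_bound_def)

text \<open>
  The inequality for which the parameters are chosen: on the left the exponents of 2 add up to at most \<open>6 * l + 3 * r + 10\<close>
  with \<open>l = block_len r > r\<close>, and on the right stands the exponent \<open>16 * l\<close>.
\<close>
lemma return_bound_small:
  "block_len (Suc r) * return_bound (Suc r) * 2 ^ (ramp_len r + r + 4) \<le> 2 ^ ramp_len (Suc r)"
proof -
  let ?l = "block_len r"
  have l: "real ?l \<le> 2 ^ ?l"
    using less_exp[of ?l] by (metis less_imp_le of_nat_less_iff of_nat_numeral of_nat_power)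
  have r: "real (Suc r) \<le> 2 ^ r"
  proof -
    have "Suc r \<le> 2 ^ r" by (rule Suc_leI[OF less_exp])
    then show ?thesis by (metis of_nat_le_iff of_nat_numeral of_nat_power)
  qed
  have p4: "(4::real) ^ ?l = 2 ^ (2 * ?l)" by (simp add: power_mult)
  have "block_len (Suc r) * return_bound (Suc r) * 2 ^ (ramp_len r + r + 4)
      = (2 ^ (r + 5) * real ?l) * (2 ^ (2 * ?l) * (2 * real (Suc r) * 2 ^ (2 * ?l)))
          * 2 ^ (ramp_len r + r + 4)"
    unfolding return_bound_def by (simp add: p4)
  also have "\<dots> \<le> (2 ^ (r + 5) * 2 ^ ?l) * (2 ^ (2 * ?l) * (2 * 2 ^ r * 2 ^ (2 * ?l)))
          * 2 ^ (?l + r + 4)"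
    by (intro mult_mono power_increasing l r order_refl)
       (use ramp_len_less[of r] in auto)
  also have "\<dots> = 2 ^ (6 * ?l + 3 * r + 10)"
    by (simp add: power_add power_mult eval_nat_numeral algebra_simps)
  also have "\<dots> \<le> 2 ^ (16 * ?l)"
    using block_len_ge[of r] by (intro power_increasing) auto
  finally show ?thesis by simp
qed

text \<open>
  All the feedback that block \<open>m\<close> can produce from coordinates of size 1 beyond its ramp is small even when compared
  with \<open>1 / 2 ^ ramp_len n\<close>, the smallest size of a transported coordinate of an earlier block \<open>n\<close>. The
  factor \<open>(1/2) ^ m / 2\<close> makes the sum over all \<open>m\<close> at most a quarter of that size.
\<close>
lemma return_bound_le:
  assumes "n < m"
  shows "block_len m * (return_bound m / 2 ^ ramp_len m) \<le> (1/2) ^ m / 2 * (1 / 2 ^ ramp_len n / 4)"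
proof -
  obtain r where m: "m = Suc r" using assms by (cases m) auto
  have "(2::real) ^ (ramp_len n + r + 4) \<le> 2 ^ (ramp_len r + r + 4)"
    using assms ramp_len_mono[of n r] by (intro power_increasing) (auto simp: m)
  then have "block_len m * return_bound m * 2 ^ (ramp_len n + r + 4)
      \<le> block_len m * return_bound m * 2 ^ (ramp_len r + r + 4)"
    by (intro mult_left_mono) (auto simp: return_bound_nonneg)
  also have "\<dots> \<le> 2 ^ ramp_len m"
    unfolding m by (rule return_bound_small)
  finally have *: "block_len m * return_bound m * 2 ^ (ramp_len n + r + 4) \<le> 2 ^ ramp_len m" .
  have "block_len m * (return_bound m / 2 ^ ramp_len m)
      = (block_len m * return_bound m * 2 ^ (ramp_len n + r + 4)) / 2 ^ ramp_len m
         / 2 ^ (ramp_len n + r + 4)"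
    by simp
  also have "\<dots> \<le> 1 / 2 ^ (ramp_len n + r + 4)"
    using * by (intro divide_right_mono) (auto simp: divide_le_eq)
  also have "\<dots> = (1/2) ^ m / 2 * (1 / 2 ^ ramp_len n / 4)"
    by (simp add: m power_add power_one_over field_simps)
  finally show ?thesis .
qed

lemma return_bound_le_weight: "return_bound n \<le> 2 ^ ramp_len n"
proof (cases n)
  case (Suc m)
  have "1 * (return_bound n / 2 ^ ramp_len n) \<le> block_len n * (return_bound n / 2 ^ ramp_len n)"
    using block_len_ge[of n] by (intro mult_right_mono) (auto simp: return_bound_nonneg)
  also have "\<dots> \<le> (1/2) ^ n / 2 * (1 / 2 ^ ramp_len 0 / 4)"
    by (rule return_bound_le) (simp add: Suc)
  also have "\<dots> \<le> 1" using power_le_one[of "1/2::real" n] by simp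
  finally show ?thesis by (simp add: divide_le_eq)
qed simp

lemma card_mod_less_le:
  fixes d L q :: nat
  shows "finite {t. t < L * q \<and> t mod L < d}" "card {t. t < L * q \<and> t mod L < d} \<le> d * q"
proof -
  show "finite {t. t < L * q \<and> t mod L < d}"
    by (rule finite_subset[of _ "{..<L * q}"]) auto
  have "{t. t < L * q \<and> t mod L < d} \<subseteq> (\<lambda>(s, p). L * p + s) ` ({..<d} \<times> {..<q})"
  proof clarify
    fix t assume t: "t < L * q" "t mod L < d"
    have "t div L < q" using t(1) by (simp add: less_mult_imp_div_less mult.commute)
    then show "t \<in> (\<lambda>(s, p). L * p + s) ` ({..<d} \<times> {..<q})"
      using t(2) by (intro image_eqI[of _ _ "(t mod L, t div L)"]) auto
  qed
  then have "card {t. t < L * q \<and> t mod L < d} \<le> card ((\<lambda>(s, p). L * p + s) ` ({..<d} \<times> {..<q}))"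
    by (intro card_mono) auto
  also have "\<dots> \<le> card ({..<d} \<times> {..<q})" by (rule card_image_le) auto
  finally show "card {t. t < L * q \<and> t mod L < d} \<le> d * q" by simp
qed

text \<open>
  Each lap contains \<open>ramp_len n\<close> times spent on the ramp. The hypothesis \<open>block_len n \<le> N + ramp_len n\<close> makes
  \<open>N\<close> at least half a lap, so that the unfinished laps at both ends only cost a constant factor.
\<close>
lemma card_ramp_visits_le:
  assumes "i < block_len n" "block_len n \<le> N + ramp_len n"
  shows "card {j. j \<le> N \<and> (i + j) mod block_len n < ramp_len n} \<le> 5 * real (N + 1) / 2 ^ n"
proof -
  let ?L = "block_len n" and ?d = "ramp_len n"
  define q where "q = Suc ((i + N) div ?L)"
  have "inj_on ((+) i) {j. j \<le> N \<and> (i + j) mod ?L < ?d}" by (simp add: inj_on_def)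
  moreover have "(+) i ` {j. j \<le> N \<and> (i + j) mod ?L < ?d} \<subseteq> {t. t < ?L * q \<and> t mod ?L < ?d}"
  proof -
    have "i + N < ?L * q"
      unfolding q_def by (metis block_len_pos dividend_less_times_div mult_Suc_right add.commute)
    then show ?thesis by auto
  qed
  ultimately have "card {j. j \<le> N \<and> (i + j) mod ?L < ?d} \<le> card {t. t < ?L * q \<and> t mod ?L < ?d}"
    by (rule card_inj_on_le) (rule card_mod_less_le)
  also have "\<dots> \<le> ?d * q" by (rule card_mod_less_le)
  finally have "card {j. j \<le> N \<and> (i + j) mod ?L < ?d} * (?L * 2 ^ n) \<le> ?d * q * (?L * 2 ^ n)"
    by (rule mult_right_mono) simp
  also have "\<dots> = (?d * 2 ^ n) * (q * ?L)" by simp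
  also have "\<dots> \<le> (?d * 2 ^ n) * (N + 2 * ?L)"
  proof (intro mult_left_mono)
    have "q * ?L \<le> i + N + ?L"
      unfolding q_def using div_times_less_eq_dividend[of "i + N" ?L] by simp
    then show "q * ?L \<le> N + 2 * ?L" using assms(1) by simp
  qed simp
  also have "\<dots> \<le> (?d * 2 ^ n) * (5 * (N + 1))"
  proof (intro mult_left_mono)
    show "N + 2 * ?L \<le> 5 * (N + 1)" using assms(2) double_ramp_len_le[of n] by simp
  qed simp
  also have "\<dots> \<le> ?L * (5 * (N + 1))"
    by (intro mult_right_mono ramp_len_le) simp
  finally have "card {j. j \<le> N \<and> (i + j) mod ?L < ?d} * 2 ^ n \<le> 5 * (N + 1)"
    by (simp add: mult.left_commute[of _ ?L])
  then have "real (card {j. j \<le> N \<and> (i + j) mod ?L < ?d}) * 2 ^ n \<le> 5 * real (N + 1)"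
    by (metis (no_types, lifting) of_nat_le_iff of_nat_mult of_nat_numeral of_nat_power)
  then show ?thesis by (simp add: pos_le_divide_eq)
qed
section \<open>The operator\<close>

definition initial_blocks :: "nat \<Rightarrow> 'a :: real_normed_field ell1 set"
  where "initial_blocks n = {v. \<forall>k\<ge>block_start n. ell1_nth v k = 0}"

lemma initial_blocksI: "(\<And>k. block_start n \<le> k \<Longrightarrow> ell1_nth v k = 0) \<Longrightarrow> v \<in> initial_blocks n"
  by (simp add: initial_blocks_def)

lemma initial_blocksD: "v \<in> initial_blocks n \<Longrightarrow> block_start n \<le> k \<Longrightarrow> ell1_nth v k = 0"
  by (simp add: initial_blocks_def)

lemma initial_blocks_0 [simp]: "v \<in> initial_blocks 0 \<longleftrightarrow> v = 0"
  by (auto simp: initial_blocks_def intro: ell1_eqI)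

lemma initial_blocks_mono: "v \<in> initial_blocks m \<Longrightarrow> m \<le> n \<Longrightarrow> v \<in> initial_blocks n"
  using block_start_mono[of m n] by (auto simp: initial_blocks_def)

lemma initial_blocks_scale: "v \<in> initial_blocks n \<Longrightarrow> ell1_scale c v \<in> initial_blocks n"
  by (auto simp: initial_blocks_def)

lemma initial_blocks_scaleR: "v \<in> initial_blocks n \<Longrightarrow> c *\<^sub>R v \<in> initial_blocks n"
  by (auto simp: initial_blocks_def)

lemma initial_blocks_diff:
  "v \<in> initial_blocks n \<Longrightarrow> w \<in> initial_blocks n \<Longrightarrow> v - w \<in> initial_blocks n"
  by (auto simp: initial_blocks_def)

lemma initial_blocks_sum:
  "(\<And>i. i \<in> I \<Longrightarrow> f i \<in> initial_blocks n) \<Longrightarrow> (\<Sum>i\<in>I. f i) \<in> initial_blocks n"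
  by (auto simp: initial_blocks_def ell1_nth_sum)

lemma initial_blocks_unit: "k < block_start n \<Longrightarrow> ell1_unit k \<in> initial_blocks n"
  by (auto simp: initial_blocks_def)

lemma initial_blocks_expand:
  assumes "v \<in> initial_blocks n"
  shows "v = (\<Sum>k<block_start n. ell1_scale (ell1_nth v k) (ell1_unit k))"
  by (rule ell1_eqI) (use initial_blocksD[OF assms] in \<open>auto simp: ell1_nth_sum_unit not_less\<close>)

text \<open>
  The parameter \<open>y\<close> is the sequence of targets of the hypercyclic vector; the operator is built from it.
\<close>
locale ell1_blocks =
  fixes y :: "nat \<Rightarrow> 'a :: {real_normed_field, banach} ell1"
  assumes y_initial: "y n \<in> initial_blocks n"
    and norm_y: "norm (y n) \<le> real n"
begin

definition start_sum :: "nat \<Rightarrow> 'a ell1"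
  where "start_sum n = (\<Sum>m<n. start_coeff m *\<^sub>R ell1_unit (block_start m))"

text \<open>
  Designed so that \<open>start_coeff n *\<^sub>R feedback n\<close> leads from the sum of the first \<open>n\<close> terms of the hypercyclic vector to
  the target \<open>y n\<close>.
\<close>
definition feedback :: "nat \<Rightarrow> 'a ell1"
  where "feedback n = (1 / start_coeff n) *\<^sub>R (y n - start_sum n)"

text \<open>
  The unit vectors of a block, rescaled such that, before the end of the block, the operator carries each one to the next.
\<close>
definition chain :: "nat \<Rightarrow> nat \<Rightarrow> 'a ell1"
  where "chain n i = weight n i *\<^sub>R ell1_unit (block_start n + i)"

definition column :: "nat \<Rightarrow> 'a ell1"
  where "column k = (let n = block_of k; i = k - block_start n in
    (1 / weight n i) *\<^sub>R
      (if Suc i < block_len n then chain n (Suc i) else feedback n - chain n 0))"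

definition T :: "'a ell1 \<Rightarrow> 'a ell1"
  where "T = ell1_extend column"

lemma start_sum_initial: "start_sum n \<in> initial_blocks n"
  unfolding start_sum_def
  by (intro initial_blocks_sum initial_blocks_scaleR initial_blocks_unit)
     (use block_end_le[of _ n 0] in simp)

lemma feedback_initial: "feedback n \<in> initial_blocks n"
  unfolding feedback_def
  by (intro initial_blocks_scaleR initial_blocks_diff y_initial start_sum_initial)

lemma norm_feedback: "norm (feedback n) \<le> 2 * real n / start_coeff n"
proof -
  have "norm (start_sum n) \<le> (\<Sum>m<n. 1)"
    unfolding start_sum_def
    by (rule sum_norm_le) (use start_coeff_le_1 start_coeff_pos less_imp_le in \<open>simp add: less_imp_le\<close>)
  then have "norm (y n - start_sum n) \<le> 2 * real n"
    using norm_triangle_ineq4[of "y n" "start_sum n"] norm_y[of n] by simp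
  then show ?thesis
    by (simp add: feedback_def divide_right_mono less_imp_le)
qed

lemma chain_0: "chain n 0 = ell1_unit (block_start n)"
  by (simp add: chain_def)

lemma norm_chain: "norm (chain n i) = weight n i"
  by (simp add: chain_def less_imp_le)

lemma chain_initial: "i < block_len n \<Longrightarrow> chain n i \<in> initial_blocks (Suc n)"
  unfolding chain_def
  by (intro initial_blocks_scaleR initial_blocks_unit) (simp add: block_start_Suc)

lemma unit_eq_chain: "ell1_unit (block_start n + i) = (1 / weight n i) *\<^sub>R chain n i"
  using weight_pos[of n i] by (simp add: chain_def del: weight_pos)

lemma column_block:
  "i < block_len n \<Longrightarrow> column (block_start n + i) = (1 / weight n i) *\<^sub>R
      (if Suc i < block_len n then chain n (Suc i) else feedback n - chain n 0)"
  by (simp add: column_def block_of_eq Let_def)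

text \<open>
  Inside the block the ratio of consecutive weights is at most 2, and at its end the weight \<open>2 ^ ramp_len n\<close>
  absorbs the large norm of the feedback vector.
\<close>
lemma norm_column: "norm (column k) \<le> 2"
proof -
  obtain n i where k: "k = block_start n + i" and i: "i < block_len n" by (rule block_cases)
  show ?thesis
  proof (cases "Suc i < block_len n")
    case True
    then show ?thesis using weight_Suc_le[of n i]
      by (simp add: k column_block i norm_chain divide_le_eq less_imp_le)
  next
    case False
    then have w: "weight n i = 2 ^ ramp_len n" using i by (intro weight_last) simp
    have "norm (feedback n - chain n 0) \<le> norm (feedback n) + 1"
      using norm_triangle_ineq4[of "feedback n" "chain n 0"] by (simp add: norm_chain)
    also have "norm (feedback n) \<le> return_bound n"
    proof -
      have "1 * (2 * real n / start_coeff n) \<le> return_bound n"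
        unfolding return_bound_def by (intro mult_right_mono) (auto simp: less_imp_le)
      then show ?thesis using norm_feedback[of n] by simp
    qed
    also have "return_bound n \<le> 2 ^ ramp_len n"
      by (rule return_bound_le_weight)
    also have "2 ^ ramp_len n + 1 \<le> 2 * (2 :: real) ^ ramp_len n" by simp
    finally show ?thesis using False
      by (simp add: k column_block i w divide_le_eq)
  qed
qed

lemma bounded_linear_T: "bounded_linear T"
  unfolding T_def by (rule bounded_linear_ell1_extend[OF norm_column])

lemma ell1_operator_T: "ell1_operator T"
  unfolding T_def by (rule ell1_operator_ell1_extend[OF norm_column])

lemma bounded_linear_funpow: "bounded_linear (T ^^ j)"
proof (induction j)
  case (Suc j)
  show ?case using bounded_linear_compose[OF bounded_linear_T Suc.IH] by (simp add: o_def)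
qed (simp add: bounded_linear_ident id_def)

lemmas linear_funpow = bounded_linear.linear[OF bounded_linear_funpow]

lemma funpow_ell1_scale: "(T ^^ j) (ell1_scale c x) = ell1_scale c ((T ^^ j) x)"
proof (induction j)
  case (Suc j)
  then show ?case by (simp add: T_def ell1_extend_scale[OF norm_column])
qed simp

lemma norm_funpow_le: "norm ((T ^^ j) x) \<le> 2 ^ j * norm x"
proof (induction j)
  case (Suc j)
  have "norm ((T ^^ Suc j) x) \<le> 2 * norm ((T ^^ j) x)"
    unfolding T_def using norm_ell1_extend_le[OF norm_column] by simp
  then show ?case using Suc.IH by simp
qed simp

lemma funpow_sums:
  "(\<lambda>k. ell1_scale (ell1_nth z k) ((T ^^ j) (ell1_unit k))) sums (T ^^ j) z"
  using bounded_linear.sums[OF bounded_linear_funpow ell1_sums_unit[of z], of j]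
  unfolding funpow_ell1_scale .

lemma funpow_initial_expand:
  assumes "v \<in> initial_blocks n"
  shows "(T ^^ j) v = (\<Sum>k<block_start n. ell1_scale (ell1_nth v k) ((T ^^ j) (ell1_unit k)))"
  by (subst initial_blocks_expand[OF assms])
     (simp add: linear_sum[OF linear_funpow] funpow_ell1_scale)

lemma T_unit: "T (ell1_unit k) = column k"
  unfolding T_def by (rule ell1_extend_unit[OF norm_column])

lemma T_chain:
  assumes "i < block_len n"
  shows "T (chain n i) = (if Suc i < block_len n then chain n (Suc i) else feedback n - chain n 0)"
proof -
  have "T (chain n i) = weight n i *\<^sub>R column (block_start n + i)"
    unfolding chain_def T_unit[symmetric]
    by (rule linear_scale[OF bounded_linear.linear[OF bounded_linear_T]])
  then show ?thesis using weight_pos[of n i] by (simp add: column_block assms del: weight_pos)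
qed

lemma T_initial:
  assumes "v \<in> initial_blocks n"
  shows "T v \<in> initial_blocks n"
proof -
  have "T (ell1_unit k) \<in> initial_blocks n" if k: "k < block_start n" for k
  proof -
    obtain m i where ki: "k = block_start m + i" "i < block_len m" by (rule block_cases)
    have m: "m < n" using k ki block_less_iff by simp
    have "chain m i' \<in> initial_blocks n" if "i' < block_len m" for i'
      by (rule initial_blocks_mono[OF chain_initial[OF that]]) (use m in simp)
    moreover have "feedback m \<in> initial_blocks n"
      by (rule initial_blocks_mono[OF feedback_initial]) (use m in simp)
    ultimately show ?thesis
      unfolding T_unit ki column_block[OF ki(2)]
      by (auto intro!: initial_blocks_scaleR initial_blocks_diff)
  qed
  then show ?thesis
    using funpow_initial_expand[OF assms, of 1]
    by (auto intro!: initial_blocks_sum initial_blocks_scale)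
qed

lemma funpow_initial: "v \<in> initial_blocks n \<Longrightarrow> (T ^^ j) v \<in> initial_blocks n"
  by (induction j) (auto intro: T_initial)

section \<open>Periodicity on finitely many blocks\<close>

lemma funpow_chain_0: "t < block_len n \<Longrightarrow> (T ^^ t) (chain n 0) = chain n t"
  by (induction t) (auto simp: T_chain)

lemma funpow_lap_chain_0: "(T ^^ block_len n) (chain n 0) = feedback n - chain n 0"
proof -
  obtain i where i: "block_len n = Suc i" using block_len_pos[of n] by (metis gr0_conv_Suc)
  show ?thesis unfolding i using i by (simp add: funpow_chain_0 T_chain)
qed

lemma funpow_lap_chain:
  assumes "i < block_len n"
  shows "(T ^^ block_len n) (chain n i) = (T ^^ i) (feedback n) - chain n i"
proof -
  have "(T ^^ block_len n) (chain n i) = (T ^^ (block_len n + i)) (chain n 0)"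
    by (simp add: funpow_add funpow_chain_0 assms)
  also have "\<dots> = (T ^^ i) ((T ^^ block_len n) (chain n 0))"
    by (subst add.commute) (simp add: funpow_add)
  also have "\<dots> = (T ^^ i) (feedback n) - chain n i"
    by (simp add: funpow_lap_chain_0 linear_diff[OF linear_funpow] funpow_chain_0 assms)
  finally show ?thesis .
qed

text \<open>
  The first lap turns a chain vector into the feedback minus that vector. The second lap fixes the feedback by
  hypothesis and subtracts it again, so that the feedback cancels.
\<close>
lemma double_lap_if_lap:
  assumes lap: "\<And>v. v \<in> initial_blocks n \<Longrightarrow> (T ^^ block_len n) v = v"
    and v: "v \<in> initial_blocks (Suc n)"
  shows "(T ^^ (2 * block_len n)) v = v"
proof -
  let ?L = "block_len n"
  have two: "(T ^^ (2 * ?L)) w = (T ^^ ?L) ((T ^^ ?L) w)" for w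
    by (simp add: mult_2 funpow_add)
  have "(T ^^ (2 * ?L)) (ell1_unit k) = ell1_unit k" if k: "k < block_start (Suc n)" for k
  proof (cases "k < block_start n")
    case True
    then show ?thesis unfolding two by (simp add: lap initial_blocks_unit)
  next
    case False
    then obtain i where i: "k = block_start n + i" "i < ?L"
      using k by (metis add_less_cancel_left block_start_Suc le_add_diff_inverse not_less)
    have "(T ^^ (2 * ?L)) (chain n i) = (T ^^ ?L) ((T ^^ i) (feedback n) - chain n i)"
      by (simp only: two funpow_lap_chain[OF i(2)])
    also have "\<dots> = (T ^^ ?L) ((T ^^ i) (feedback n)) - (T ^^ ?L) (chain n i)"
      by (rule linear_diff[OF linear_funpow])
    also have "\<dots> = chain n i"
      by (simp add: lap funpow_initial feedback_initial funpow_lap_chain i(2))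
    finally show ?thesis
      unfolding i(1) unit_eq_chain by (simp add: linear_scale[OF linear_funpow])
  qed
  then show ?thesis
    unfolding funpow_initial_expand[OF v] by (simp flip: initial_blocks_expand[OF v])
qed

lemma funpow_lap_initial: "v \<in> initial_blocks n \<Longrightarrow> (T ^^ block_len n) v = v"
proof (induction n arbitrary: v)
  case 0
  then show ?case by (simp add: linear_0[OF linear_funpow] del: block_len.simps)
next
  case (Suc n)
  show ?case
    by (rule funpow_dvd_period[OF double_lap_if_lap[OF Suc.IH Suc.prems] double_block_len_dvd_Suc])
qed

lemma funpow_double_lap: "v \<in> initial_blocks (Suc n) \<Longrightarrow> (T ^^ (2 * block_len n)) v = v"
  using funpow_lap_initial by (rule double_lap_if_lap)

lemma norm_funpow_initial_le:
  assumes "v \<in> initial_blocks n"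
  shows "norm ((T ^^ s) v) \<le> 4 ^ block_len (n - 1) * norm v"
proof (cases n)
  case 0
  then show ?thesis using assms by (simp add: linear_0[OF linear_funpow])
next
  case (Suc m)
  let ?p = "2 * block_len m"
  have "(T ^^ s) v = (T ^^ (s mod ?p)) v"
    using funpow_mod_eq[OF funpow_double_lap[of v m], of s] assms Suc by simp
  also have "norm \<dots> \<le> 2 ^ (s mod ?p) * norm v" by (rule norm_funpow_le)
  also have "\<dots> \<le> 2 ^ ?p * norm v"
    by (intro mult_right_mono power_increasing) (auto intro: less_imp_le)
  finally show ?thesis using Suc by (simp add: power_mult)
qed

lemma norm_funpow_feedback: "norm ((T ^^ s) (feedback n)) \<le> return_bound n"
proof -
  have "norm ((T ^^ s) (feedback n)) \<le> 4 ^ block_len (n - 1) * norm (feedback n)"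
    by (rule norm_funpow_initial_le[OF feedback_initial])
  also have "\<dots> \<le> return_bound n"
    unfolding return_bound_def by (intro mult_left_mono norm_feedback) simp
  finally show ?thesis .
qed

text \<open>
  Within its own block the first vector simply runs around, up to a sign. What it has deposited in earlier
  blocks is, at any time, nothing or a single iterate of the feedback vector, since by periodicity earlier deposits cancel in
  pairs; and it has deposited nothing before the end of the first lap.
\<close>
lemma funpow_chain_0_cases:
  obtains \<sigma> r where
    "(T ^^ t) (chain n 0) = \<sigma> *\<^sub>R chain n (t mod block_len n) + r" "\<bar>\<sigma>\<bar> = 1"
    "r \<in> initial_blocks n" "norm r \<le> return_bound n" "t < block_len n \<Longrightarrow> r = 0"
proof -
  let ?L = "block_len n"
  define t' where "t' = t mod (2 * ?L)"
  have "(T ^^ t) (chain n 0) = (T ^^ t') (chain n 0)"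
    unfolding t'_def by (rule funpow_mod_eq[OF funpow_double_lap, symmetric])
      (rule chain_initial, simp)
  moreover have t'_mod: "t' mod ?L = t mod ?L" unfolding t'_def by (simp add: mod_mod_cancel)
  moreover have t'_less: "t' < 2 * ?L" unfolding t'_def by simp
  ultimately show ?thesis
  proof (cases "t' < ?L")
    case True
    then show ?thesis
      using that[of 1 0] t'_mod \<open>(T ^^ t) (chain n 0) = (T ^^ t') (chain n 0)\<close>
      by (simp add: funpow_chain_0 return_bound_nonneg initial_blocks_def)
  next
    case False
    define s where "s = t' - ?L"
    have s: "t' = s + ?L" "s < ?L" using False t'_less by (auto simp: s_def)
    have "(T ^^ t) (chain n 0) = (T ^^ s) (feedback n) - chain n s"
      by (simp add: \<open>(T ^^ t) (chain n 0) = (T ^^ t') (chain n 0)\<close> s funpow_add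
          funpow_lap_chain_0 linear_diff[OF linear_funpow] funpow_chain_0)
    moreover have "s = t mod ?L" using t'_mod s by simp
    moreover have "\<not> t < ?L" using False unfolding t'_def by auto
    ultimately show ?thesis
      using that[of "-1" "(T ^^ s) (feedback n)"]
      by (simp add: norm_funpow_feedback funpow_initial feedback_initial)
  qed
qed

section \<open>Orbits are rarely small\<close>

text \<open>
  The matrix of an iterate of the operator is block triangular. A diagonal block is a weighted cyclic permutation, and the
  entries above the diagonal come from the feedback only.
\<close>
lemma norm_coordinate_funpow_unit:
  fixes i j m n p :: nat
  assumes i: "i < block_len m" and p: "p < block_len n"
  defines "e \<equiv> ell1_nth ((T ^^ j) (ell1_unit (block_start m + i))) (block_start n + p)"
  shows "m < n \<Longrightarrow> e = 0"
    and "m = n \<Longrightarrow> p = (i + j) mod block_len n \<Longrightarrow> norm e = weight n p / weight n i"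
    and "m = n \<Longrightarrow> p \<noteq> (i + j) mod block_len n \<Longrightarrow> e = 0"
    and "n < m \<Longrightarrow> norm e \<le> return_bound m / weight m i"
    and "n < m \<Longrightarrow> i + j < block_len m \<Longrightarrow> e = 0"
proof -
  let ?q = "(i + j) mod block_len m"
  obtain \<sigma> r where T: "(T ^^ (i + j)) (chain m 0) = \<sigma> *\<^sub>R chain m ?q + r" and \<sigma>: "\<bar>\<sigma>\<bar> = 1"
    and r: "r \<in> initial_blocks m" "norm r \<le> return_bound m" "i + j < block_len m \<Longrightarrow> r = 0"
    by (rule funpow_chain_0_cases[of "i + j" m]) auto
  have "(T ^^ j) (ell1_unit (block_start m + i)) = (1 / weight m i) *\<^sub>R (T ^^ j) (chain m i)"
    unfolding unit_eq_chain by (rule linear_scale[OF linear_funpow])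
  also have "(T ^^ j) (chain m i) = \<sigma> *\<^sub>R chain m ?q + r"
    unfolding T[symmetric] by (subst add.commute) (simp add: funpow_add funpow_chain_0 i)
  finally have e: "e = (1 / weight m i) *\<^sub>R
      (\<sigma> *\<^sub>R ell1_nth (chain m ?q) (block_start n + p) + ell1_nth r (block_start n + p))"
    by (simp add: e_def)
  have chain: "ell1_nth (chain m ?q) (block_start n + p) = (if m = n \<and> ?q = p then weight n p *\<^sub>R 1 else 0)"
    using block_eq_iff[OF p, of ?q m] by (auto simp: chain_def)
  have r0: "ell1_nth r (block_start n + p) = 0" if "m \<le> n"
    using initial_blocksD[OF r(1)] block_start_mono[OF that] by simp
  show "m < n \<Longrightarrow> e = 0" "m = n \<Longrightarrow> p \<noteq> (i + j) mod block_len n \<Longrightarrow> e = 0"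
    using chain r0 by (auto simp: e)
  show "norm e = weight n p / weight n i" if "m = n" "p = (i + j) mod block_len n"
    using chain r0 that \<sigma> by (simp add: e abs_mult less_imp_le)
  show "norm e \<le> return_bound m / weight m i" if "n < m"
  proof -
    have "norm (ell1_nth r (block_start n + p)) \<le> return_bound m"
      using norm_ell1_nth_le r(2) by (rule order_trans)
    then show ?thesis using chain that by (simp add: e divide_right_mono less_imp_le)
  qed
  show "n < m \<Longrightarrow> i + j < block_len m \<Longrightarrow> e = 0"
    using chain r(3) by (auto simp: e)
qed

text \<open>
  The transported coordinate \<open>i\<close> of block \<open>n\<close> survives if every coordinate of a later block that has
  completed a lap by time \<open>j\<close> has size at most \<open>A\<close> when transported beyond the ramp: by \<open>return_bound_le\<close>
  the feedback of all these coordinates then adds up to at most \<open>A / 2 ^ ramp_len n / 4\<close>.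
\<close>
lemma norm_funpow_ge:
  assumes i: "i < block_len n" and A: "0 \<le> A"
    and late: "\<And>m i'. n < m \<Longrightarrow> i' < block_len m \<Longrightarrow> block_len m \<le> i' + j \<Longrightarrow>
      norm (ell1_nth z (block_start m + i')) \<le> A / 2 ^ ramp_len m * weight m i'"
  shows "norm ((T ^^ j) z) \<ge>
    norm (ell1_nth z (block_start n + i)) / weight n i * weight n ((i + j) mod block_len n)
      - A / 2 ^ ramp_len n / 4"
proof -
  define p where "p = (i + j) mod block_len n"
  define k where "k = block_start n + p"
  define k0 where "k0 = block_start n + i"
  define C where "C = A / 2 ^ ramp_len n / 4"
  have p: "p < block_len n" by (simp add: p_def)
  have C: "C \<ge> 0" using A by (simp add: C_def)
  define f where "f k' = ell1_nth z k' * ell1_nth ((T ^^ j) (ell1_unit k')) k" for k'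
  \<comment> \<open>\<open>f\<close> lists the contributions to coordinate \<open>k\<close>; \<open>g\<close> lists the disturbances of the transported coordinate \<open>k0\<close>.\<close>
  define g where "g k' = (if k' = k0 then 0 else f k')" for k'
  define S where "S = ell1_nth ((T ^^ j) z) k"
  have f: "f sums S"
    using bounded_linear.sums[OF bounded_linear_ell1_nth funpow_sums, of z j k]
    unfolding f_def S_def by simp
  have g: "g sums (S - f k0)"
    using sums_diff[OF f sums_single[of k0 f]]
    by (rule sums_cong[THEN iffD1, rotated]) (simp add: g_def)
  have g_block: "(\<Sum>i'<block_len m. norm (g (block_start m + i'))) \<le> C * ((1/2) ^ m / 2)" for m
  proof (cases "n < m")
    case False
    have "g (block_start m + i') = 0" if i': "i' < block_len m" for i'
    proof (cases "m = n \<and> i' = i")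
      case True
      then show ?thesis by (simp add: g_def k0_def)
    next
      case neq: False
      have "ell1_nth ((T ^^ j) (ell1_unit (block_start m + i'))) k = 0"
      proof (cases "m = n")
        case True
        then have "p \<noteq> (i' + j) mod block_len n"
          using neq add_mod_inj[of i' "block_len n" i j] i i' by (auto simp: p_def)
        then show ?thesis unfolding k_def
          using norm_coordinate_funpow_unit(3)[OF i' p True] by simp
      next
        case m: False
        then have "m < n" using False by simp
        then show ?thesis unfolding k_def
          by (rule norm_coordinate_funpow_unit(1)[OF i' p])
      qed
      then show ?thesis by (simp add: g_def f_def)
    qed
    then have "(\<Sum>i'<block_len m. norm (g (block_start m + i'))) = 0" by simp
    then show ?thesis using C by simp
  next
    case True
    have "norm (g (block_start m + i')) \<le> A * (return_bound m / 2 ^ ramp_len m)"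
      if i': "i' < block_len m" for i'
    proof (cases "i' + j < block_len m")
      case early: True
      have "g (block_start m + i') = 0"
        using norm_coordinate_funpow_unit(5)[OF i' p True early]
        by (simp add: g_def f_def k_def)
      then show ?thesis using A by (simp add: return_bound_nonneg)
    next
      case False
      have "norm (g (block_start m + i'))
          \<le> norm (ell1_nth z (block_start m + i'))
            * norm (ell1_nth ((T ^^ j) (ell1_unit (block_start m + i'))) k)"
        by (simp add: g_def f_def norm_mult)
      also have "\<dots> \<le> (A / 2 ^ ramp_len m * weight m i') * (return_bound m / weight m i')"
        unfolding k_def
        using late[OF True i'] False norm_coordinate_funpow_unit(4)[OF i' p True] A
        by (intro mult_mono) (auto simp: less_imp_le)
      also have "\<dots> = A * (return_bound m / 2 ^ ramp_len m)"
        using weight_pos[of m i'] by (simp del: weight_pos)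
      finally show ?thesis .
    qed
    then have "(\<Sum>i'<block_len m. norm (g (block_start m + i')))
        \<le> (\<Sum>i'<block_len m. A * (return_bound m / 2 ^ ramp_len m))"
      by (intro sum_mono) simp
    also have "\<dots> = A * (block_len m * (return_bound m / 2 ^ ramp_len m))" by simp
    also have "\<dots> \<le> A * ((1/2) ^ m / 2 * (1 / 2 ^ ramp_len n / 4))"
      by (intro mult_left_mono return_bound_le True A)
    also have "\<dots> = C * ((1/2) ^ m / 2)" by (simp add: C_def)
    finally show ?thesis .
  qed
  have blocks: "(\<Sum>k'<block_start M. norm (g k')) \<le> C * (1 - (1/2) ^ M)" for M
  proof (induction M)
    case (Suc M)
    have "(\<Sum>k'<block_start (Suc M). norm (g k')) \<le> C * (1 - (1/2) ^ M) + C * ((1/2) ^ M / 2)"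
      unfolding block_start_Suc sum_lessThan_add by (intro add_mono Suc.IH g_block)
    then show ?case by (simp add: algebra_simps)
  qed simp
  have "norm (\<Sum>k'<N. g k') \<le> C" for N
  proof -
    have "norm (\<Sum>k'<N. g k') \<le> (\<Sum>k'<N. norm (g k'))" by (rule norm_sum)
    also have "\<dots> \<le> (\<Sum>k'<block_start N. norm (g k'))"
      by (intro sum_mono2) (use block_start_ge[of N] in auto)
    also have "\<dots> \<le> C * (1 - (1/2) ^ N)" by (rule blocks)
    also have "\<dots> \<le> C * 1" by (intro mult_left_mono C) simp
    finally show ?thesis by simp
  qed
  then have "norm (S - f k0) \<le> C"
    using tendsto_norm[OF g[unfolded sums_def]] by (intro LIMSEQ_le_const2) auto
  moreover have "norm (f k0) = norm (ell1_nth z k0) / weight n i * weight n p"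
    using norm_coordinate_funpow_unit(2)[OF i p refl p_def]
    by (simp add: f_def norm_mult k0_def k_def)
  moreover have "norm (f k0) - norm (S - f k0) \<le> norm S"
    using norm_triangle_ineq4[of S "S - f k0"] by simp
  moreover have "norm S \<le> norm ((T ^^ j) z)"
    unfolding S_def by (rule norm_ell1_nth_le)
  ultimately show ?thesis unfolding p_def k0_def C_def by linarith
qed

text \<open>
  The coordinate followed is the one of the last heavy block that is relevant up to the time considered, where block \<open>m\<close>
  is heavy (\<open>m \<in> B\<close>) if \<open>good m i\<close> holds for some position \<open>i\<close>. A later heavy block has not yet disturbed it at time \<open>j\<close>
  if \<open>j + ramp_len m < block_len m\<close>: then only coordinates that started beyond the ramp, where they cannot grow any more,
  have completed a lap, and their size is at most the maximum \<open>A\<close>.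
\<close>
lemma orbit_rarely_small:
  assumes "z \<noteq> 0"
  obtains c where "c > 0" "upper_density {j. norm ((T ^^ j) z) < c} \<le> 0"
proof -
  obtain k0 where k0: "0 < norm (ell1_nth z k0)" "\<And>k. norm (ell1_nth z k) \<le> norm (ell1_nth z k0)"
    using ell1_max_coordinate[OF assms] by blast
  define A where "A = norm (ell1_nth z k0)"
  have A: "A > 0" "\<And>k. norm (ell1_nth z k) \<le> A" using k0 by (auto simp: A_def)
  define good where "good m i \<longleftrightarrow> i < block_len m \<and>
    A / 2 ^ ramp_len m * weight m i \<le> norm (ell1_nth z (block_start m + i))" for m i
  define B where "B = {m. \<exists>i. good m i}"
  have lower: "norm ((T ^^ j) z) \<ge> A / 2 ^ ramp_len n * (weight n ((i + j) mod block_len n) - 1/4)"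
    if good: "good n i" and late: "\<And>m. n < m \<Longrightarrow> m \<in> B \<Longrightarrow> j + ramp_len m < block_len m" for n i j
  proof -
    have "norm (ell1_nth z (block_start m + i')) \<le> A / 2 ^ ramp_len m * weight m i'"
      if m: "n < m" and i': "i' < block_len m" "block_len m \<le> i' + j" for m i'
    proof (cases "m \<in> B")
      case True
      have "weight m i' = 2 ^ ramp_len m"
        using late[OF m True] i' by (intro weight_after_ramp) simp
      then show ?thesis using A(2) by simp
    next
      case False
      then show ?thesis using i' unfolding B_def good_def by force
    qed
    then have "norm ((T ^^ j) z) \<ge> norm (ell1_nth z (block_start n + i)) / weight n i
        * weight n ((i + j) mod block_len n) - A / 2 ^ ramp_len n / 4"
      using good A(1) by (intro norm_funpow_ge) (auto simp: good_def)
    moreover have "A / 2 ^ ramp_len n \<le> norm (ell1_nth z (block_start n + i)) / weight n i"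
      using good by (simp add: good_def pos_le_divide_eq)
    then have "A / 2 ^ ramp_len n * weight n ((i + j) mod block_len n)
        \<le> norm (ell1_nth z (block_start n + i)) / weight n i * weight n ((i + j) mod block_len n)"
      by (rule mult_right_mono) (simp add: less_imp_le)
    ultimately show ?thesis by (simp add: right_diff_distrib)
  qed
  obtain n0 i0 where k0_eq: "k0 = block_start n0 + i0" "i0 < block_len n0" by (rule block_cases)
  have "A / 2 ^ ramp_len n0 * weight n0 i0 \<le> A / 2 ^ ramp_len n0 * 2 ^ ramp_len n0"
    using A(1) by (intro mult_left_mono weight_le) simp
  then have "good n0 i0" using k0_eq by (simp add: good_def A_def)
  then have "n0 \<in> B" unfolding B_def by blast
  then have "B \<noteq> {}" by blast
  show ?thesis
  proof (cases "finite B")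
    case True
    define n where "n = Max B"
    have "n \<in> B" unfolding n_def by (rule Max_in[OF True \<open>B \<noteq> {}\<close>])
    then obtain i where good: "good n i" unfolding B_def by blast
    have late: "j + ramp_len m < block_len m" if "n < m" "m \<in> B" for m j
      using Max_ge[OF True that(2)] that(1) by (simp add: n_def)
    have "A / 2 ^ ramp_len n / 2 \<le> norm ((T ^^ j) z)" for j
    proof -
      have "A / 2 ^ ramp_len n * (1/2)
          \<le> A / 2 ^ ramp_len n * (weight n ((i + j) mod block_len n) - 1/4)"
        using A(1) weight_ge_1[of n "(i + j) mod block_len n"] by (intro mult_left_mono) auto
      then show ?thesis using lower[OF good late, of j] by simp
    qed
    then have "{j. norm ((T ^^ j) z) < A / 2 ^ ramp_len n / 2} = {}" by (auto simp: not_less)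
    then have "upper_density {j. norm ((T ^^ j) z) < A / 2 ^ ramp_len n / 2} \<le> 0"
      by (intro upper_density_le_0I) auto
    then show ?thesis using A(1) by (intro that[of "A / 2 ^ ramp_len n / 2"]) auto
  next
    case False
    have "upper_density {j. norm ((T ^^ j) z) < A / 2} \<le> 0"
    proof (rule upper_density_le_0I)
      fix e :: real assume "e > 0"
      obtain r where r: "5 / e < 2 ^ r" using real_arch_pow[of 2 "5 / e"] by auto
      obtain n1 where n1: "n1 \<in> B" "n1 \<ge> r" using False by (meson infinite_nat_iff_unbounded_le)
      have "real (card ({j. norm ((T ^^ j) z) < A / 2} \<inter> {0..N})) / real (N + 1) \<le> e"
        if N: "N \<ge> block_len n1" for N
      proof -
        \<comment> \<open>the heavy blocks whose ramp can have influenced earlier blocks up to time \<open>N\<close>\<close>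
        define F where "F = {m \<in> B. block_len m \<le> N + ramp_len m}"
        have "F \<subseteq> {..2 * N}"
        proof
          fix m assume "m \<in> F"
          then have "block_len m \<le> 2 * N" using double_ramp_len_le[of m] by (simp add: F_def)
          then show "m \<in> {..2 * N}" using block_len_ge[of m] by simp
        qed
        then have fin: "finite F" by (rule finite_subset) simp
        have n1F: "n1 \<in> F" using n1 N by (simp add: F_def)
        define n where "n = Max F"
        have n: "n \<in> F" unfolding n_def using fin n1F by (intro Max_in) auto
        then obtain i where good: "good n i" unfolding F_def B_def by blast
        have "r \<le> n" using Max_ge[OF fin n1F] n1(2) by (simp add: n_def)
        have late: "j + ramp_len m < block_len m" if "j \<le> N" "n < m" "m \<in> B" for j m
        proof -
          have "m \<notin> F" using Max_ge[OF fin, of m] that(2) by (auto simp: n_def)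
          then show ?thesis using that by (simp add: F_def)
        qed
        have visits: "{j. norm ((T ^^ j) z) < A / 2} \<inter> {0..N}
            \<subseteq> {j. j \<le> N \<and> (i + j) mod block_len n < ramp_len n}"
        proof (rule subsetI)
          fix j assume "j \<in> {j. norm ((T ^^ j) z) < A / 2} \<inter> {0..N}"
          then have j: "norm ((T ^^ j) z) < A / 2" "j \<le> N" by auto
          have "(i + j) mod block_len n < ramp_len n"
          proof (rule ccontr)
            assume "\<not> (i + j) mod block_len n < ramp_len n"
            then have w: "weight n ((i + j) mod block_len n) = 2 ^ ramp_len n"
              by (intro weight_after_ramp) simp
            have "(1::real) \<le> 2 ^ ramp_len n" by simp
            then have "1 / 2 * 2 ^ ramp_len n \<le> weight n ((i + j) mod block_len n) - 1 / 4"
              unfolding w by linarith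
            then have "A / 2 ^ ramp_len n * (1 / 2 * 2 ^ ramp_len n)
                \<le> A / 2 ^ ramp_len n * (weight n ((i + j) mod block_len n) - 1 / 4)"
              using A(1) by (intro mult_left_mono) auto
            also have "\<dots> \<le> norm ((T ^^ j) z)"
              using late[OF j(2)] by (intro lower[OF good]) auto
            finally show False using j(1) by simp
          qed
          then show "j \<in> {j. j \<le> N \<and> (i + j) mod block_len n < ramp_len n}"
            using j(2) by blast
        qed
        have "finite {j. j \<le> N \<and> (i + j) mod block_len n < ramp_len n}"
          by (rule finite_subset[of _ "{..N}"]) auto
        then have "card ({j. norm ((T ^^ j) z) < A / 2} \<inter> {0..N})
            \<le> card {j. j \<le> N \<and> (i + j) mod block_len n < ramp_len n}"
          using visits by (rule card_mono)
        then have "real (card ({j. norm ((T ^^ j) z) < A / 2} \<inter> {0..N}))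
            \<le> real (card {j. j \<le> N \<and> (i + j) mod block_len n < ramp_len n})"
          by (rule of_nat_mono)
        also have "\<dots> \<le> 5 * real (N + 1) / 2 ^ n"
        proof (rule card_ramp_visits_le)
          show "i < block_len n" using good unfolding good_def by blast
          show "block_len n \<le> N + ramp_len n" using n unfolding F_def by blast
        qed
        finally have "real (card ({j. norm ((T ^^ j) z) < A / 2} \<inter> {0..N})) / real (N + 1) \<le> 5 / 2 ^ n"
          by (rule divide_le_of_le_mult) simp
        also have "\<dots> \<le> e"
        proof -
          have "5 / e < 2 ^ n"
            using r power_increasing[OF \<open>r \<le> n\<close>, of "2::real"] by linarith
          then show ?thesis
            using \<open>e > 0\<close> by (simp add: pos_divide_less_eq pos_divide_le_eq mult.commute)
        qed
        finally show ?thesis .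
      qed
      then show "\<forall>\<^sub>F N in sequentially.
          real (card ({j. norm ((T ^^ j) z) < A / 2} \<inter> {0..N})) / real (N + 1) \<le> e"
        by (rule eventually_sequentiallyI)
    qed
    then show ?thesis using A(1) by (intro that[of "A / 2"]) auto
  qed
qed

section \<open>An explicit hypercyclic vector\<close>

definition hypercyclic_vector :: "'a ell1"
  where "hypercyclic_vector = (\<Sum>m. start_coeff m *\<^sub>R ell1_unit (block_start m))"

lemma start_coeff_tail_le: "start_coeff (r + Suc n) \<le> 1 / 4 ^ block_len n * (1/4) ^ r"
proof -
  have "(1/4::real) ^ block_len (n + r) \<le> (1/4) ^ (block_len n + r)"
    using block_len_add_le[of n r] by (intro power_decreasing) auto
  then show ?thesis by (simp add: power_add power_one_over add.commute mult.commute)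
qed

lemma norm_hypercyclic_vector_tail:
  "norm (hypercyclic_vector - start_sum (Suc n)) \<le> 2 / 4 ^ block_len n"
proof -
  let ?u = "\<lambda>m. start_coeff m *\<^sub>R ell1_unit (block_start m) :: 'a ell1"
  have geo: "(\<lambda>r. 1 / 4 ^ block_len n * (1/4::real) ^ r) sums (1 / 4 ^ block_len n * (1 / (1 - 1/4)))" for n
    by (intro sums_mult geometric_sums) simp
  have norm_u: "norm (?u (r + Suc n)) \<le> 1 / 4 ^ block_len n * (1/4) ^ r" for r n
    using start_coeff_tail_le[of r n] by (simp add: less_imp_le)
  have norm_summable: "summable (\<lambda>r. norm (?u (r + Suc n)))" for n
    by (rule summable_comparison_test'[OF sums_summable[OF geo[of n]], of 0]) (use norm_u in simp)
  have summable: "summable ?u"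
    using summable_norm_cancel[OF norm_summable[of 0]] summable_iff_shift[of ?u "Suc 0"] by blast
  have "hypercyclic_vector - start_sum (Suc n) = (\<Sum>r. ?u (r + Suc n))"
    unfolding hypercyclic_vector_def start_sum_def
    by (rule suminf_minus_initial_segment[OF summable, symmetric])
  also have "norm \<dots> \<le> (\<Sum>r. norm (?u (r + Suc n)))"
    by (rule summable_norm[OF norm_summable])
  also have "\<dots> \<le> (\<Sum>r. 1 / 4 ^ block_len n * (1/4) ^ r)"
    by (intro suminf_le norm_u norm_summable sums_summable[OF geo])
  also have "\<dots> = 1 / 4 ^ block_len n * (1 / (1 - 1/4))" by (rule sums_unique[OF geo, symmetric])
  also have "\<dots> \<le> 2 / 4 ^ block_len n" by (simp add: field_simps)
  finally show ?thesis .
qed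

text \<open>
  At time \<open>block_len n\<close> the terms before the \<open>n\<close>-th are back at their initial position, and one lap has
  replaced the \<open>n\<close>-th term by what is missing to \<open>y n\<close>, up to its own small negative. The later terms have grown by a factor
  of at most \<open>2 ^ block_len n\<close>, from a size of order \<open>1 / 4 ^ block_len n\<close>.
\<close>
lemma hypercyclic_vector_visits:
  "norm ((T ^^ block_len n) hypercyclic_vector - y n) \<le> 2 * (1/2) ^ n"
proof -
  let ?T = "T ^^ block_len n" and ?tail = "hypercyclic_vector - start_sum (Suc n)"
  have "?T hypercyclic_vector = ?T (start_sum n + start_coeff n *\<^sub>R chain n 0 + ?tail)"
    by (simp add: start_sum_def chain_0)
  also have "\<dots> = start_sum n + start_coeff n *\<^sub>R (feedback n - chain n 0) + ?T ?tail"
    by (simp add: linear_add[OF linear_funpow] linear_scale[OF linear_funpow]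
        funpow_lap_initial[OF start_sum_initial] funpow_lap_chain_0)
  also have "\<dots> = y n - start_coeff n *\<^sub>R chain n 0 + ?T ?tail"
    using start_coeff_pos[of n] by (simp add: feedback_def scaleR_diff_right del: start_coeff_pos)
  finally have "?T hypercyclic_vector - y n = ?T ?tail - start_coeff n *\<^sub>R chain n 0" by simp
  also have "norm \<dots> \<le> norm (?T ?tail) + norm (start_coeff n *\<^sub>R chain n 0)"
    by (rule norm_triangle_ineq4)
  also have "norm (?T ?tail) \<le> 2 ^ block_len n * (2 / 4 ^ block_len n)"
    by (rule order_trans[OF norm_funpow_le]) (intro mult_left_mono norm_hypercyclic_vector_tail, simp)
  also have "\<dots> = 2 * (1/2) ^ block_len n"
  proof -
    have "(4::real) ^ block_len n = 2 ^ block_len n * 2 ^ block_len n"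
      by (simp flip: power_mult_distrib)
    then show ?thesis by (simp add: power_one_over)
  qed
  also have "\<dots> \<le> 2 * (1/2) ^ Suc n"
    using block_len_ge[of n] by (intro mult_left_mono power_decreasing) auto
  also have "norm (start_coeff n *\<^sub>R chain n 0) \<le> (1/2) ^ n"
  proof (cases n)
    case (Suc m)
    have "(1/4::real) ^ block_len m \<le> (1/4) ^ n"
      using block_len_ge[of m] Suc by (intro power_decreasing) auto
    also have "\<dots> \<le> (1/2) ^ n" by (intro power_mono) auto
    finally show ?thesis by (simp add: Suc norm_chain power_one_over)
  qed (simp add: norm_chain)
  finally show ?thesis by simp
qed

end

section \<open>Linear dynamics of the operator\<close>

locale ell1_blocks_dense = ell1_blocks +
  assumes y_dense: "e > 0 \<Longrightarrow> \<exists>n\<ge>N. norm (y n - x) < e"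
begin

lemma hypercyclic_T: "hypercyclic T"
proof -
  have "x \<in> closure (range (\<lambda>j. (T ^^ j) hypercyclic_vector))" for x
    unfolding closure_approachable
  proof (intro allI impI)
    fix e :: real assume "e > 0"
    obtain N where N: "(1/2::real) ^ N < e / 4"
      using real_arch_pow_inv[of "e / 4" "1/2"] \<open>e > 0\<close> by auto
    obtain n where n: "n \<ge> N" "norm (y n - x) < e / 2" using y_dense[of "e / 2"] \<open>e > 0\<close> by auto
    have "(1/2::real) ^ n \<le> (1/2) ^ N" using n(1) by (intro power_decreasing) auto
    then have "norm ((T ^^ block_len n) hypercyclic_vector - y n) < e / 2"
      using hypercyclic_vector_visits[of n] N by linarith
    then have "dist ((T ^^ block_len n) hypercyclic_vector) x < e"
      using n(2) norm_triangle_ineq[of "(T ^^ block_len n) hypercyclic_vector - y n" "y n - x"]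
      by (simp add: dist_norm)
    then show "\<exists>v\<in>range (\<lambda>j. (T ^^ j) hypercyclic_vector). dist v x < e" by blast
  qed
  then show ?thesis unfolding hypercyclic_def by blast
qed

lemma chaotic_T: "chaotic T"
proof -
  have "periodic_vector T (y n)" for n
    unfolding periodic_vector_def using funpow_lap_initial[OF y_initial] block_len_pos by blast
  then have "x \<in> closure {v. periodic_vector T v}" for x
    unfolding closure_approachable dist_norm using y_dense[of _ 0 x] by blast
  then show ?thesis using hypercyclic_T by (auto simp: chaotic_def)
qed

lemma not_U_frequently_hypercyclic_T: "\<not> U_frequently_hypercyclic T"
proof
  assume "U_frequently_hypercyclic T"
  then obtain x where
    x: "\<And>U. open U \<Longrightarrow> U \<noteq> {} \<Longrightarrow> upper_density (return_set T x U) > 0"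
    unfolding U_frequently_hypercyclic_def by blast
  show False
  proof (cases "x = 0")
    case True
    \<comment> \<open>The orbit of 0 never visits the complement of \<open>{0}\<close>.\<close>
    have "ell1_unit 0 \<noteq> (0 :: 'a ell1)" by (metis norm_ell1_unit norm_zero zero_neq_one)
    then have "upper_density (return_set T x (- {0})) > 0" by (intro x) auto
    moreover have "return_set T x (- {0}) = {}"
      by (simp add: return_set_def True linear_0[OF linear_funpow])
    moreover have "upper_density {} \<le> 0" by (rule upper_density_le_0I) simp
    ultimately show False by simp
  next
    case False
    then obtain c where c: "c > 0" "upper_density {j. norm ((T ^^ j) x) < c} \<le> 0"
      by (rule orbit_rarely_small)
    then show False using x[of "ball 0 c"] by (simp add: return_set_def not_le[symmetric])
  qed
qed

lemma not_frequently_hypercyclic_T: "\<not> frequently_hypercyclic T"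
proof
  assume "frequently_hypercyclic T"
  then obtain x where "\<forall>U. open U \<and> U \<noteq> {} \<longrightarrow> lower_density (return_set T x U) > 0"
    unfolding frequently_hypercyclic_def ..
  then have "\<forall>U. open U \<and> U \<noteq> {} \<longrightarrow> upper_density (return_set T x U) > 0"
    using less_le_trans[OF _ lower_density_le_upper_density] by simp
  then have "U_frequently_hypercyclic T"
    unfolding U_frequently_hypercyclic_def by (rule exI)
  then show False using not_U_frequently_hypercyclic_T by simp
qed

lemma not_distributionally_chaotic_T: "\<not> distributionally_chaotic T"
proof
  assume "distributionally_chaotic T"
  then obtain \<Gamma> \<epsilon> where \<Gamma>: "uncountable \<Gamma>"
    and close: "\<forall>x\<in>\<Gamma>. \<forall>x'\<in>\<Gamma>. \<forall>\<tau>. x \<noteq> x' \<and> \<tau> > 0 \<longrightarrow>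
      lower_density {n. norm ((T ^^ n) x - (T ^^ n) x') < \<epsilon>} = 0 \<and>
      upper_density {n. norm ((T ^^ n) x - (T ^^ n) x') < \<tau>} = 1"
    unfolding distributionally_chaotic_def by (elim exE conjE)
  obtain x where x: "x \<in> \<Gamma>" using \<Gamma> by fastforce
  have "\<not> \<Gamma> \<subseteq> {x}" using \<Gamma> countable_subset by blast
  then obtain x' where x': "x' \<in> \<Gamma>" "x \<noteq> x'" by blast
  obtain c where c: "c > 0" "upper_density {j. norm ((T ^^ j) (x - x')) < c} \<le> 0"
    using orbit_rarely_small[of "x - x'"] x' by auto
  have "upper_density {j. norm ((T ^^ j) x - (T ^^ j) x') < c} = 1"
    using close[rule_format, OF x x'(1), of c] x'(2) c(1) by simp
  then show False
    using c(2) by (simp add: linear_diff[OF linear_funpow])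
qed

end

text \<open>
  What the construction asks of the scalars is a complete separable normed field, which covers the real and the complex case.
\<close>
lemma chaotic_operator_exists:
  "\<exists>T :: 'a :: {real_normed_field, banach, second_countable_topology} ell1 \<Rightarrow> 'a ell1.
    ell1_operator T \<and> chaotic T \<and> \<not> U_frequently_hypercyclic T \<and>
    \<not> distributionally_chaotic T \<and> \<not> frequently_hypercyclic T"
proof -
  obtain y :: "nat \<Rightarrow> 'a ell1"
    where y: "\<And>n k. block_start n \<le> k \<Longrightarrow> ell1_nth (y n) k = 0" "\<And>n. norm (y n) \<le> real n"
      "\<And>x e N. e > 0 \<Longrightarrow> \<exists>n\<ge>N. norm (y n - x) < e"
    using ell1_dense_sequence[OF block_start_ge] by blast
  interpret ell1_blocks_dense y
    by unfold_locales (use y in \<open>auto intro: initial_blocksI\<close>)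
  show ?thesis
    using ell1_operator_T chaotic_T not_U_frequently_hypercyclic_T
      not_distributionally_chaotic_T not_frequently_hypercyclic_T by blast
qed

theorem theorem1p2:
  shows "(\<exists>T :: real ell1 \<Rightarrow> real ell1.
            ell1_operator T \<and> chaotic T \<and>
            \<not> U_frequently_hypercyclic T \<and> \<not> distributionally_chaotic T \<and>
            \<not> frequently_hypercyclic T)
       \<and> (\<exists>T :: complex ell1 \<Rightarrow> complex ell1.
            ell1_operator T \<and> chaotic T \<and>
            \<not> U_frequently_hypercyclic T \<and> \<not> distributionally_chaotic T \<and>
            \<not> frequently_hypercyclic T)"
  by (intro conjI chaotic_operator_exists)

end
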